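(* Let $f$ be an entire function of finite order $\rho(f)$. Let $\varepsilon>0$ and suppose that $$\operatorname{logarea}\left\{ z\in\Delta : \left|\frac{zf'(z)}{f(z)}\right| < |z|^{\rho(f)/2+\varepsilon}\ \text{ or }\ |f(z)| < \exp\left(|z|^{\varepsilon}\right) \right\} <\infty.$$ Then $$\operatorname{logarea}(\Delta\setminus A(f))<\infty.$$ In particular, $\operatorname{area} A(f)>0$. If, in addition, $F(f)$ does not have a multiply connected component, then $$\operatorname{logarea}(\Delta\setminus (A(f)\cap J(f)))<\infty$$ and thus $\operatorname{area}(A(f)\cap J(f))>0$.
   Context: Throughout, $f$ is a non-linear entire function and $f^n$ denotes its $n$-th iterate. The Fatou set $F(f)$ is the set of all $z\in\mathbb{C}$ at which the iterates $f^n$ form a normal family (i.e. they are normal in some neighborhood of $z$); the Julia set is $J(f)=\mathbb{C}\setminus F(f)$. A component of $F(f)$ is a connected component; it is multiply connected if it is not simply connected. Let $M(r,f)=\max_{|z|=r}|f(z)|$. The order of $f$ is $\rho(f)=\limsup_{r\to\infty}\frac{\log\log M(r,f)}{\log r}$. Let $M^n(r,f)$ be the $n$-th iterate of $M(r,f)$ with respect to the first variable: $M^1(r,f)=M(r,f)$ and $M^n(r,f)=M(M^{n-1}(r,f),f)$ for $n\ge 2$. There exists $R>0$ such that $M(r,f)>r$ for all $r\ge R$; with such an $R$, the fast escaping set $A(f)$ is the set of all $z\in\mathbb{C}$ for which there exists $L\in\mathbb{N}$ such that $|f^n(z)|\ge M^{n-L}(R,f)$ for all $n>L$. (The definition is independent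 of the choice of $R$.) $\operatorname{area} A$ is the two-dimensional Lebesgue measure of a measurable set $A\subset\mathbb{C}$, the logarithmic area is $\operatorname{logarea} A=\int_A \frac{dx\,dy}{|z|^2}$ (with $z=x+iy$), and $\Delta=\{z\in\mathbb{C}: |z|\ge 1\}$. *)

theory Defs
  imports "HOL-Complex_Analysis.Complex_Analysis"
begin

text \<open>
  A family on \<open>U\<close> is normal if every sequence in it has a subsequence that converges, uniformly on
  compact subsets of \<open>U\<close>, to a finite limit function or to \<open>\<infinity>\<close>. On a connected open \<open>U\<close>, and for
  holomorphic functions, this is normality with respect to the spherical metric; \<open>fatou_set\<close> only
  uses it on neighbourhoods that may be shrunk to discs.
\<close>
definition normal_family_on :: "complex set \<Rightarrow> (complex \<Rightarrow> complex) set \<Rightarrow> bool" where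
  "normal_family_on U \<F> \<longleftrightarrow>
     (\<forall>h :: nat \<Rightarrow> complex \<Rightarrow> complex. range h \<subseteq> \<F> \<longrightarrow>
       (\<exists>k :: nat \<Rightarrow> nat. strict_mono k \<and>
         ((\<exists>g. \<forall>K. compact K \<and> K \<subseteq> U \<longrightarrow> uniform_limit K (h \<circ> k) g sequentially) \<or>
          (\<forall>K. compact K \<and> K \<subseteq> U \<longrightarrow>
             (\<forall>B :: real. \<forall>\<^sub>F n in sequentially. \<forall>z\<in>K. norm (h (k n) z) > B)))))"

definition fatou_set :: "(complex \<Rightarrow> complex) \<Rightarrow> complex set" where
  "fatou_set f = {z. \<exists>U. open U \<and> z \<in> U \<and> normal_family_on U (range (\<lambda>n. f ^^ n))}"

definition julia_set :: "(complex \<Rightarrow> complex) \<Rightarrow> complex set" where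
  "julia_set f = - fatou_set f"

text \<open>For continuous \<open>f\<close> and \<open>r \<ge> 0\<close> the supremum is attained.\<close>
definition max_modulus :: "(complex \<Rightarrow> complex) \<Rightarrow> real \<Rightarrow> real" where
  "max_modulus f r = (SUP z\<in>sphere 0 r. norm (f z))"

definition entire_order :: "(complex \<Rightarrow> complex) \<Rightarrow> ereal" where
  "entire_order f = Limsup at_top (\<lambda>r. ereal (ln (ln (max_modulus f r)) / ln r))"

text \<open>
  The radius is a parameter; it is meant to satisfy \<open>R > 0\<close> and \<open>max_modulus f r > r\<close> for all
  \<open>r \<ge> R\<close>. Among such radii, the set does not depend on the choice of \<open>R\<close>.
\<close>
definition fast_escaping_set :: "(complex \<Rightarrow> complex) \<Rightarrow> real \<Rightarrow> complex set" where
  "fast_escaping_set f R =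
     {z. \<exists>L. \<forall>n>L. norm ((f ^^ n) z) \<ge> (max_modulus f ^^ (n - L)) R}"

definition logarea :: "complex set \<Rightarrow> ennreal" where
  "logarea A = (\<integral>\<^sup>+ z\<in>A. ennreal (1 / (norm z)\<^sup>2) \<partial>lebesgue)"

abbreviation area :: "complex set \<Rightarrow> ennreal" where
  "area \<equiv> emeasure lebesgue"

definition Delta :: "complex set" where
  "Delta = {z. norm z \<ge> 1}"

lemma norm_le_max_modulus:
  assumes "f holomorphic_on UNIV" "norm z = r"
  shows "norm (f z) \<le> max_modulus f r"
proof -
  have "continuous_on (sphere 0 r) (\<lambda>z. norm (f z))"
    by (intro continuous_on_norm continuous_on_subset[OF holomorphic_on_imp_continuous_on[OF assms(1)]]) auto
  then have "compact ((\<lambda>z. norm (f z)) ` sphere 0 r)"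
    by (intro compact_continuous_image) auto
  then have "bdd_above ((\<lambda>z. norm (f z)) ` sphere 0 r)"
    by (intro bounded_imp_bdd_above compact_imp_bounded)
  then show ?thesis
    unfolding max_modulus_def using assms(2) by (intro cSUP_upper) auto
qed

text \<open>Radii as required for \<open>fast_escaping_set\<close> exist for every non-linear entire function.\<close>
lemma ex_fast_escaping_radius:
  assumes hol: "f holomorphic_on UNIV"
    and nonlin: "\<nexists>a b. \<forall>z. f z = a * z + b"
  shows "\<exists>R>0. \<forall>r\<ge>R. max_modulus f r > r"
proof (rule ccontr)
  assume "\<not> ?thesis"
  then have ex: "\<exists>r\<ge>R. max_modulus f r \<le> r" if "R > 0" for R
    using that by (meson linorder_not_less)
  have zero: "(deriv ^^ n) f 0 = 0" if n: "n \<ge> 2" for n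
  proof (rule ccontr)
    assume nz: "(deriv ^^ n) f 0 \<noteq> 0"
    define c where "c = norm ((deriv ^^ n) f 0)"
    have c: "c > 0" using nz by (simp add: c_def)
    define R where "R = 1 + fact n / c"
    have R: "R \<ge> 1" using c by (simp add: R_def)
    then obtain r where r: "r \<ge> R" "max_modulus f r \<le> r" using ex[of R] by auto
    have r1: "r \<ge> 1" using r R by linarith
    have "c \<le> fact n * r / r ^ n"
      unfolding c_def
    proof (rule Cauchy_inequality)
      show "f holomorphic_on ball 0 r" "continuous_on (cball 0 r) f"
        using hol holomorphic_on_subset holomorphic_on_imp_continuous_on continuous_on_subset by blast+
      show "norm (f x) \<le> r" if "norm (0 - x) = r" for x
        using norm_le_max_modulus[OF hol, of x r] r that by simp
    qed (use r1 in auto)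
    also have "\<dots> \<le> fact n * r / r ^ 2"
      using r1 n by (intro divide_left_mono power_increasing) auto
    also have "\<dots> = fact n / r" using r1 by (simp add: power2_eq_square)
    finally have "c * r \<le> fact n" using r1 by (simp add: field_simps)
    moreover have "c * R > fact n" using c by (simp add: R_def field_simps)
    moreover have "c * R \<le> c * r" using r c by simp
    ultimately show False by linarith
  qed
  have "f z = deriv f 0 * z + f 0" for z
  proof -
    have "(\<lambda>n. (deriv ^^ n) f 0 / fact n * (z - 0) ^ n) sums f z"
      by (rule holomorphic_power_series[of f 0 "norm z + 1"])
         (use hol holomorphic_on_subset in auto)
    moreover have "(\<lambda>n. (deriv ^^ n) f 0 / fact n * (z - 0) ^ n) sums
        (\<Sum>n<2. (deriv ^^ n) f 0 / fact n * (z - 0) ^ n)"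
      using zero by (intro sums_finite) (auto simp: not_less)
    ultimately have "f z = (\<Sum>n<2. (deriv ^^ n) f 0 / fact n * (z - 0) ^ n)"
      using sums_unique2 by blast
    then show ?thesis by (simp add: numeral_2_eq_2)
  qed
  then show False using nonlin by blast
qed

end

theory Submission
  imports Defs
begin

text \<open>
  Let \<open>E\<close> be the exceptional set whose logarithmic area is finite by hypothesis. Outside \<open>E\<close> and
  far from the origin, \<open>f\<close> moves a point \<open>z\<close> to one of modulus at least \<open>exp (\<bar>z\<bar>\<^sup>\<epsilon>)\<close>, and in the
  logarithmic metric \<open>\<bar>dz\<bar> / \<bar>z\<bar>\<close> it expands by the factor \<open>\<bar>z f'(z) / f(z)\<bar> \<ge> \<bar>z\<bar> powr (\<rho>/2 + \<epsilon>)\<close>.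
  So the point of the proof is that most orbits never meet \<open>E\<close>.

  Passing to the preimage divides logarithmic area by the square of the expansion factor, at least
  \<open>r powr (\<rho> + 2\<epsilon>)\<close> near \<open>\<bar>z\<bar> = r\<close>, and multiplies it by the number of preimages. The latter is at
  most about \<open>ln (M(8r, f))\<close>, by the inequality of Jensen type
  \<open>card_preimages_le_ln_max_modulus\<close>, and hence \<open>O(r powr (\<rho> + \<epsilon>))\<close> by the definition of the order. The
  quotient is \<open>O(r powr (-\<epsilon>))\<close>, and summation over the annuli between \<open>2\<^sup>k r\<close> and
  \<open>2\<^sup>k\<^sup>+\<^sup>1 r\<close> gives \<open>logarea_preimage_le_half\<close>: sufficiently far out, taking preimages at
  least halves the logarithmic area. The points that reach \<open>E\<close> after exactly \<open>n\<close> good steps thus have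
  logarithmic area at most \<open>2 powr (-n)\<close> times that of \<open>E\<close>, and the union over \<open>n\<close> is still finite. What
  remains of \<open>\<Delta>\<close> is, up to a bounded set, a forward invariant set \<open>X\<close> of good points
  (\<open>ex_logarea_cofinite_good_set\<close>).

  Points of \<open>X\<close> escape fast. Finite order gives \<open>M(r, f) \<le> exp (r powr K)\<close>, and on logarithmic
  scale the iteration \<open>s \<mapsto> exp (\<epsilon> s)\<close> outruns \<open>t \<mapsto> exp (K t)\<close> once it starts with
  \<open>s \<ge> c t\<close> for a suitable constant \<open>c\<close> (\<open>iterates_exceed_max_modulus\<close>).

  If all Fatou components are simply connected, then the points of \<open>X\<close> lie in the Julia set. By
  Picard's theorem \<open>f \<circ> f\<close> has a fixed point \<open>p\<close>. It does not escape, so it lies in no Fatou component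
  that contains an escaping point. If \<open>z \<in> X\<close> were in the Fatou set, a disc around it would thus be
  mapped by every iterate into a simply connected domain that omits \<open>p\<close>. A logarithm of \<open>w - p\<close> is
  defined there, its image contains no two points that differ by \<open>2\<pi>\<i>\<close>, and Bloch's theorem bounds
  the logarithmic derivative of \<open>f\<^sup>n - p\<close> at \<open>z\<close> independently of \<open>n\<close>
  (\<open>deriv_funpow_le_of_simply_connected\<close>). The expansion along orbits in \<open>X\<close> contradicts this bound.

  Both areas are positive because \<open>\<Delta>\<close> has infinite logarithmic area.
\<close>

section \<open>Area of holomorphic images with multiplicity\<close>

text \<open>
  The change of variables theorem is stated for \<open>real^'n\<close>; this isomorphism carries it over to
  the complex plane.
\<close>
definition complex_of_vec :: "real^2 \<Rightarrow> complex" where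
  "complex_of_vec v = Complex (v $ 1) (v $ 2)"

definition vec_of_complex :: "complex \<Rightarrow> real^2" where
  "vec_of_complex z = vector [Re z, Im z]"

lemma complex_of_vec_inverse [simp]: "complex_of_vec (vec_of_complex z) = z"
  by (simp add: complex_of_vec_def vec_of_complex_def)

lemma vec_of_complex_inverse [simp]: "vec_of_complex (complex_of_vec v) = v"
  by (simp add: complex_of_vec_def vec_of_complex_def vec_eq_iff forall_2)

lemma bounded_linear_complex_of_vec: "bounded_linear complex_of_vec"
  by (rule linear_conv_bounded_linear[THEN iffD1], rule linearI)
     (auto simp: complex_of_vec_def complex_eq_iff)

lemma bounded_linear_vec_of_complex: "bounded_linear vec_of_complex"
  by (rule linear_conv_bounded_linear[THEN iffD1], rule linearI)
     (auto simp: vec_of_complex_def vec_eq_iff forall_2)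

lemma borel_measurable_complex_of_vec [measurable]: "complex_of_vec \<in> borel_measurable borel"
  by (intro borel_measurable_continuous_onI linear_continuous_on bounded_linear_complex_of_vec)

lemma borel_measurable_vec_of_complex [measurable]: "vec_of_complex \<in> borel_measurable borel"
  by (intro borel_measurable_continuous_onI linear_continuous_on bounded_linear_vec_of_complex)

lemma distr_lborel_complex_of_vec: "distr lborel borel complex_of_vec = lborel"
proof (rule lborel_eqI[symmetric])
  fix l u :: complex
  assume le: "\<And>b. b \<in> Basis \<Longrightarrow> l \<bullet> b \<le> u \<bullet> b"
  have Basis2: "(Basis :: (real^2) set) = {axis 1 1, axis 2 1}"
    by (auto simp: Basis_vec_def UNIV_2)
  have neq: "axis 1 1 \<noteq> (axis 2 1 :: real^2)"
    by (simp add: axis_eq_axis)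
  have lu: "Re l \<le> Re u" "Im l \<le> Im u"
    using le[of 1] le[of \<i>] by (auto simp: Basis_complex_def)
  have "complex_of_vec -` box l u = box (vec_of_complex l) (vec_of_complex u)"
    by (auto simp: complex_of_vec_def vec_of_complex_def mem_box Basis2 inner_axis
        Basis_complex_def)
  then have "emeasure (distr lborel borel complex_of_vec) (box l u)
      = emeasure lborel (box (vec_of_complex l) (vec_of_complex u))"
    by (simp add: emeasure_distr)
  also have "\<dots> = ennreal ((Re u - Re l) * (Im u - Im l))"
    using lu neq
    by (subst emeasure_lborel_box)
       (auto simp: Basis2 vec_of_complex_def inner_axis inner_diff_left)
  also have "\<dots> = (\<Prod>b\<in>Basis. (u - l) \<bullet> b)"
    by (simp add: Basis_complex_def)
  finally show "emeasure (distr lborel borel complex_of_vec) (box l u) = (\<Prod>b\<in>Basis. (u - l) \<bullet> b)" .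
qed simp

lemma det_complex_multiplication:
  "det (matrix (\<lambda>h. vec_of_complex (c * complex_of_vec h))) = (norm c)\<^sup>2"
  by (simp add: det_2 matrix_def vec_of_complex_def complex_of_vec_def axis_def
      cmod_power2 flip: power2_eq_square)

text \<open>
  The Jacobian determinant of a holomorphic map is \<open>\<bar>f'\<bar>\<^sup>2\<close>. The map need only be injective on an open set
  \<open>V\<close> around \<open>S\<close>: its continuous inverse there makes the image of a Borel set a Borel set. Both sides
  may be infinite.
\<close>
lemma area_injective_image:
  assumes V: "open V" and hol: "f holomorphic_on V" and inj: "inj_on f V"
    and S: "S \<in> sets borel" "S \<subseteq> V"
  shows "f ` S \<in> sets borel"
    and "emeasure lborel (f ` S) = (\<integral>\<^sup>+z\<in>S. ennreal ((norm (deriv f z))\<^sup>2) \<partial>lborel)"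
proof -
  have fV: "open (f ` V)"
    using open_mapping_thm3[OF hol V inj] .
  obtain g where g: "g holomorphic_on f ` V" "\<And>z. z \<in> V \<Longrightarrow> g (f z) = z"
    using holomorphic_has_inverse[OF hol V inj] by metis
  have "f ` S = {w \<in> space (restrict_space borel (f ` V)). g w \<in> S}"
    using S(2) g(2) by (auto simp: space_restrict_space)
  also have "\<dots> \<in> sets (restrict_space borel (f ` V))"
  proof -
    have [measurable]: "g \<in> borel_measurable (restrict_space borel (f ` V))"
      using g(1) fV by (intro borel_measurable_continuous_on_restrict holomorphic_on_imp_continuous_on)
    show ?thesis using S(1) by measurable
  qed
  finally show fS: "f ` S \<in> sets borel"
    using fV by (subst (asm) sets_restrict_space_iff) auto
  define S' where "S' = complex_of_vec -` S"
  define F where "F = vec_of_complex \<circ> f \<circ> complex_of_vec"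
  define D where "D = (\<lambda>z h. vec_of_complex (deriv f (complex_of_vec z) * complex_of_vec h))"
  define m where "m = (\<lambda>z. (norm (deriv f (complex_of_vec z)))\<^sup>2)"
  have S': "S' \<in> sets borel"
    unfolding S'_def using measurable_sets[OF borel_measurable_complex_of_vec S(1)] by simp
  have der: "(F has_derivative D x) (at x within S')" if "x \<in> S'" for x
  proof -
    have x: "complex_of_vec x \<in> V" using that S(2) by (auto simp: S'_def)
    have "(f has_field_derivative deriv f (complex_of_vec x)) (at (complex_of_vec x))"
      using holomorphic_derivI[OF hol V x] .
    then have *: "(f has_derivative (\<lambda>h. deriv f (complex_of_vec x) * h)) (at (complex_of_vec x))"
      by (simp add: has_field_derivative_def)
    have T: "(complex_of_vec has_derivative complex_of_vec) (at x)"
      "(vec_of_complex has_derivative vec_of_complex) (at y)" for x y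
      using bounded_linear_complex_of_vec bounded_linear_vec_of_complex
      by (auto intro: bounded_linear_imp_has_derivative)
    have "(F has_derivative D x) (at x)"
      unfolding F_def D_def comp_def
      by (rule has_derivative_compose[OF has_derivative_compose[OF T(1) *] T(2)])
    then show ?thesis by (rule has_derivative_at_withinI)
  qed
  have injF: "inj_on F S'"
    using inj S(2) unfolding inj_on_def F_def S'_def
    by (metis comp_apply complex_of_vec_inverse in_mono vec_of_complex_inverse vimageE)
  have det: "\<bar>det (matrix (D x))\<bar> = m x" for x
    unfolding D_def m_def by (simp add: det_complex_multiplication)
  have iff: "F ` S' \<in> lmeasurable \<and> measure lebesgue (F ` S') = c \<longleftrightarrow> (m has_integral c) S'" for c
    using has_measure_differentiable_image[of S' F D c] der injF S' by (simp add: det)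
  have FS': "F ` S' = complex_of_vec -` (f ` S)"
  proof (intro equalityI subsetI)
    fix x assume "x \<in> complex_of_vec -` (f ` S)"
    then obtain s where s: "s \<in> S" "complex_of_vec x = f s" by auto
    then have "x = F (vec_of_complex s)"
      unfolding F_def by (metis comp_apply complex_of_vec_inverse vec_of_complex_inverse)
    then show "x \<in> F ` S'" using s by (auto simp: S'_def)
  qed (auto simp: F_def S'_def)
  have FS'b: "F ` S' \<in> sets borel"
    using measurable_sets[OF borel_measurable_complex_of_vec fS] FS' by simp
  have m_meas: "(\<lambda>x. m x * indicator S' x) \<in> borel_measurable borel"
  proof -
    have "(\<lambda>z. indicator S z *\<^sub>R deriv f z) \<in> borel_measurable borel"
    proof -
      have "(\<lambda>z. indicator V z *\<^sub>R deriv f z) \<in> borel_measurable borel"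
        using V by (intro borel_measurable_continuous_on_indicator)
           (auto intro!: holomorphic_on_imp_continuous_on holomorphic_deriv hol)
      then have "(\<lambda>z. indicator S z *\<^sub>R (indicator V z *\<^sub>R deriv f z)) \<in> borel_measurable borel"
        using S(1) by measurable
      also have "(\<lambda>z. indicator S z *\<^sub>R (indicator V z *\<^sub>R deriv f z)) = (\<lambda>z. indicator S z *\<^sub>R deriv f z)"
        using S(2) by (intro ext) (auto simp: indicator_def of_bool_def)
      finally show ?thesis .
    qed
    then have "(\<lambda>x. (norm (indicator S (complex_of_vec x) *\<^sub>R deriv f (complex_of_vec x)))\<^sup>2) \<in> borel_measurable borel"
      by measurable
    also have "(\<lambda>x. (norm (indicator S (complex_of_vec x) *\<^sub>R deriv f (complex_of_vec x)))\<^sup>2) = (\<lambda>x. m x * indicator S' x)"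
      by (auto simp: m_def S'_def indicator_def)
    finally show ?thesis .
  qed
  have m0: "m x \<ge> 0" for x by (simp add: m_def)
  \<comment> \<open>The change of variables theorem speaks of finite integrals only, hence the case distinction.\<close>
  define I where "I = (\<integral>\<^sup>+x. ennreal (m x * indicator S' x) \<partial>lborel)"
  have "emeasure lborel (F ` S') = I"
  proof (cases "I < \<infinity>")
    case True
    then obtain c where c: "I = ennreal c" "c \<ge> 0"
      by (cases I rule: ennreal_cases) auto
    have "((\<lambda>x. m x * indicator S' x) has_integral c) UNIV"
      using nn_integral_has_integral[OF m_meas _ _ c(2)] c m0 by (simp add: I_def)
    then have "(m has_integral c) S'"
      by (subst has_integral_restrict_UNIV[symmetric])
         (simp add: indicator_def of_bool_def if_distrib[of "\<lambda>y. _ * y"] cong: if_cong)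
    then have "F ` S' \<in> lmeasurable \<and> measure lebesgue (F ` S') = c" by (simp add: iff)
    then have "emeasure lebesgue (F ` S') = ennreal c"
      by (simp add: emeasure_eq_measure2)
    then show ?thesis using FS'b c by simp
  next
    case False
    show ?thesis
    proof (rule ccontr)
      assume "emeasure lborel (F ` S') \<noteq> I"
      then have "emeasure lebesgue (F ` S') < \<infinity>"
        using False FS'b by (auto simp flip: less_top)
      then have "F ` S' \<in> lmeasurable"
        using FS'b by (intro fmeasurableI) auto
      then have "(m has_integral measure lebesgue (F ` S')) S'" using iff by blast
      then have "I = ennreal (measure lebesgue (F ` S'))"
        using nn_integral_has_integral_lebesgue[of S' m, OF m0]
        unfolding I_def by (simp add: mult.commute)
      then show False using False by simp
    qed
  qed
  moreover have "emeasure lborel (F ` S') = emeasure lborel (f ` S)"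
  proof -
    have "emeasure lborel (f ` S) = emeasure (distr lborel borel complex_of_vec) (f ` S)"
      by (simp add: distr_lborel_complex_of_vec)
    then show ?thesis using fS by (simp add: emeasure_distr FS')
  qed
  moreover have "(\<integral>\<^sup>+z\<in>S. ennreal ((norm (deriv f z))\<^sup>2) \<partial>lborel) = I"
  proof -
    have "(\<lambda>x. ennreal (m (vec_of_complex x) * indicator S' (vec_of_complex x))) \<in> borel_measurable borel"
      using measurable_compose[OF borel_measurable_vec_of_complex m_meas] by simp
    also have "(\<lambda>x. ennreal (m (vec_of_complex x) * indicator S' (vec_of_complex x)))
        = (\<lambda>z. ennreal ((norm (deriv f z))\<^sup>2) * indicator S z)"
      by (auto simp: m_def S'_def indicator_def)
    finally have meas: "(\<lambda>z. ennreal ((norm (deriv f z))\<^sup>2) * indicator S z) \<in> borel_measurable borel" .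
    have "(\<integral>\<^sup>+z\<in>S. ennreal ((norm (deriv f z))\<^sup>2) \<partial>lborel)
       = (\<integral>\<^sup>+z. ennreal ((norm (deriv f z))\<^sup>2) * indicator S z \<partial>distr lborel borel complex_of_vec)"
      by (simp add: distr_lborel_complex_of_vec)
    also have "\<dots> = (\<integral>\<^sup>+x. ennreal ((norm (deriv f (complex_of_vec x)))\<^sup>2)
        * indicator S (complex_of_vec x) \<partial>lborel)"
      by (rule nn_integral_distr) (use meas in auto)
    also have "\<dots> = I"
      unfolding I_def by (intro nn_integral_cong) (auto simp: m_def S'_def indicator_def)
    finally show ?thesis .
  qed
  ultimately show "emeasure lborel (f ` S) = (\<integral>\<^sup>+z\<in>S. ennreal ((norm (deriv f z))\<^sup>2) \<partial>lborel)"
    by simp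
qed

lemma borel_measurable_entire:
  assumes "f holomorphic_on UNIV"
  shows "f \<in> borel_measurable borel"
  using assms by (intro borel_measurable_continuous_onI holomorphic_on_imp_continuous_on)

text \<open>
  The area formula says that \<open>f\<close> transports the measure with density \<open>\<bar>f'\<bar>\<^sup>2\<close> on \<open>S\<close> to area on
  \<open>f ` S\<close>, so it extends from sets to weights \<open>h\<close>.
\<close>
lemma nn_integral_injective_image:
  assumes hol: "f holomorphic_on UNIV" and V: "open V" and inj: "inj_on f V"
    and S: "S \<in> sets borel" "S \<subseteq> V" and h: "h \<in> borel_measurable borel"
  shows "(\<integral>\<^sup>+z\<in>S. h (f z) * ennreal ((norm (deriv f z))\<^sup>2) \<partial>lborel)
    = (\<integral>\<^sup>+w\<in>f ` S. h w \<partial>lborel)"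
proof -
  have [measurable]: "f \<in> borel_measurable borel" "deriv f \<in> borel_measurable borel"
    using hol by (auto intro!: borel_measurable_entire holomorphic_deriv)
  have [measurable]: "S \<in> sets borel" "h \<in> borel_measurable borel" by (fact S h)+
  have holV: "f holomorphic_on V" using hol holomorphic_on_subset by blast
  have [measurable]: "f ` S \<in> sets borel"
    using area_injective_image(1)[OF V holV inj S] .
  define M where "M = density lborel (\<lambda>z. ennreal ((norm (deriv f z))\<^sup>2) * indicator S z)"
  have eq: "distr M borel f = density lborel (indicator (f ` S))"
  proof (rule measure_eqI)
    fix B assume "B \<in> sets (distr M borel f)"
    then have B [measurable]: "B \<in> sets borel" by simp
    have fB [measurable]: "f -` B \<in> sets borel"
      using measurable_sets[of f borel borel B] by simp
    have SB: "S \<inter> f -` B \<in> sets borel" "S \<inter> f -` B \<subseteq> V" using S(2) by auto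
    have "emeasure (distr M borel f) B = (\<integral>\<^sup>+z\<in>S \<inter> f -` B. ennreal ((norm (deriv f z))\<^sup>2) \<partial>lborel)"
      by (simp add: emeasure_distr M_def emeasure_density mult.assoc indicator_inter_arith)
    also have "\<dots> = emeasure lborel (f ` (S \<inter> f -` B))"
      using area_injective_image(2)[OF V holV inj SB] by simp
    also have "f ` (S \<inter> f -` B) = f ` S \<inter> B" by auto
    also have "emeasure lborel (f ` S \<inter> B) = emeasure (density lborel (indicator (f ` S))) B"
      by (simp add: emeasure_density indicator_inter_arith[symmetric])
    finally show "emeasure (distr M borel f) B = emeasure (density lborel (indicator (f ` S))) B" .
  qed simp
  have "(\<integral>\<^sup>+z\<in>S. h (f z) * ennreal ((norm (deriv f z))\<^sup>2) \<partial>lborel) = (\<integral>\<^sup>+z. h (f z) \<partial>M)"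
    unfolding M_def by (subst nn_integral_density) (auto intro!: nn_integral_cong simp: mult_ac)
  also have "\<dots> = (\<integral>\<^sup>+w. h w \<partial>distr M borel f)"
    by (subst nn_integral_distr) (auto simp: M_def)
  also have "\<dots> = (\<integral>\<^sup>+w\<in>f ` S. h w \<partial>lborel)"
    unfolding eq by (subst nn_integral_density) (auto intro!: nn_integral_cong simp: mult_ac)
  finally show ?thesis .
qed

lemma countable_injective_cover:
  assumes hol: "f holomorphic_on UNIV" and nz: "\<And>z. z \<in> S \<Longrightarrow> deriv f z \<noteq> 0"
  obtains V :: "nat \<Rightarrow> complex set"
  where "\<And>i. open (V i)" "\<And>i. inj_on f (V i)" "S \<subseteq> (\<Union>i. V i)"
proof -
  let ?F = "{V. open V \<and> inj_on f V}"
  obtain F where F: "F \<subseteq> ?F" "countable F" "\<Union>F = \<Union>?F"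
    using Lindelof[of ?F] by auto
  define V where "V = from_nat_into (insert {} F)"
  have rV: "range V = insert {} F"
    unfolding V_def using F(2) by (intro range_from_nat_into) auto
  have "V i \<in> insert {} F" for i using rV by auto
  then have V: "V i \<in> ?F" for i using F(1) by (metis (mono_tags, lifting) inj_on_empty insertE mem_Collect_eq open_empty subsetD)
  have "S \<subseteq> \<Union>F"
  proof
    fix z assume "z \<in> S"
    then obtain r where "r > 0" "inj_on f (ball z r)"
      using has_complex_derivative_locally_injective[OF hol, of z] nz by auto
    then have "z \<in> \<Union>?F" by (intro UnionI[of "ball z r"]) auto
    then show "z \<in> \<Union>F" using F(3) by simp
  qed
  also have "\<Union>F = (\<Union>i. V i)" using rV by auto
  finally show ?thesis using V by (intro that[of V]) auto
qed

text \<open>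
  Cut \<open>S\<close> into countably many disjoint pieces on which \<open>f\<close> is injective. The images of the pieces
  cover each point \<open>w\<close> at most as often as \<open>w\<close> has preimages in \<open>S\<close>.
\<close>
lemma nn_integral_image_multiplicity_le:
  assumes hol: "f holomorphic_on UNIV" and S: "S \<in> sets borel"
    and nz: "\<And>z. z \<in> S \<Longrightarrow> deriv f z \<noteq> 0" and h: "h \<in> borel_measurable borel"
    and N: "\<And>w. finite {z \<in> S. f z = w}" "\<And>w. card {z \<in> S. f z = w} \<le> N"
  shows "(\<integral>\<^sup>+z\<in>S. h (f z) * ennreal ((norm (deriv f z))\<^sup>2) \<partial>lborel)
    \<le> of_nat N * (\<integral>\<^sup>+w. h w \<partial>lborel)"
proof -
  have [measurable]: "f \<in> borel_measurable borel" "deriv f \<in> borel_measurable borel"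
    using hol by (auto intro!: borel_measurable_entire holomorphic_deriv)
  have [measurable]: "S \<in> sets borel" "h \<in> borel_measurable borel" by (fact S h)+
  obtain V :: "nat \<Rightarrow> complex set"
    where V: "\<And>i. open (V i)" "\<And>i. inj_on f (V i)" "S \<subseteq> (\<Union>i. V i)"
    using countable_injective_cover[OF hol nz] by blast
  define P where "P i = S \<inter> disjointed V i" for i
  have PV: "P i \<subseteq> V i" for i using disjointed_subset[of V i] by (auto simp: P_def)
  have [measurable]: "V i \<in> sets borel" for i using V(1) by auto
  have [measurable]: "P i \<in> sets borel" for i
    unfolding P_def disjointed_def by measurable
  have disj: "disjoint_family P"
    using disjoint_family_disjointed[of V] by (auto simp: disjoint_family_on_def P_def)
  have UP: "(\<Union>i. P i) = S"
    unfolding P_def using V(3) UN_disjointed_eq[of V] by auto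
  have [measurable]: "f ` P i \<in> sets borel" for i
    using area_injective_image(1)[OF V(1) holomorphic_on_subset[OF hol] V(2) _ PV] by auto
  have "(\<integral>\<^sup>+z\<in>S. h (f z) * ennreal ((norm (deriv f z))\<^sup>2) \<partial>lborel)
     = (\<integral>\<^sup>+z. (\<Sum>i. h (f z) * ennreal ((norm (deriv f z))\<^sup>2) * indicator (P i) z) \<partial>lborel)"
    by (intro nn_integral_cong) (simp add: suminf_indicator[OF disj] UP)
  also have "\<dots> = (\<Sum>i. \<integral>\<^sup>+z\<in>P i. h (f z) * ennreal ((norm (deriv f z))\<^sup>2) \<partial>lborel)"
    by (intro nn_integral_suminf) measurable
  also have "\<dots> = (\<Sum>i. \<integral>\<^sup>+w\<in>f ` P i. h w \<partial>lborel)"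
    using nn_integral_injective_image[OF hol V(1) V(2) _ PV h] by simp
  also have "\<dots> = (\<integral>\<^sup>+w. (\<Sum>i. h w * indicator (f ` P i) w) \<partial>lborel)"
    by (intro nn_integral_suminf[symmetric]) measurable
  also have "\<dots> \<le> (\<integral>\<^sup>+w. of_nat N * h w \<partial>lborel)"
  proof (intro nn_integral_mono)
    fix w
    have "(\<Sum>i<n. indicator (f ` P i) w) \<le> (of_nat N :: ennreal)" for n
    proof -
      \<comment> \<open>Distinct pieces that meet the fibre over \<open>w\<close> contribute distinct preimages of \<open>w\<close>.\<close>
      define I where "I = {i. i < n \<and> w \<in> f ` P i}"
      have "\<exists>z. \<forall>i\<in>I. z i \<in> P i \<and> f (z i) = w"
        by (intro bchoice) (auto simp: I_def)
      then obtain z where z: "\<And>i. i \<in> I \<Longrightarrow> z i \<in> P i \<and> f (z i) = w" by blast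
      have "inj_on z I"
        using z disj unfolding inj_on_def disjoint_family_on_def by (metis IntI UNIV_I empty_iff)
      then have "card I = card (z ` I)" by (simp add: card_image)
      also have "\<dots> \<le> card {z \<in> S. f z = w}"
        using z N(1) by (intro card_mono) (auto simp: P_def)
      also have "\<dots> \<le> N" by (rule N)
      finally have "card I \<le> N" .
      moreover have "(\<Sum>i<n. indicator (f ` P i) w) = (of_nat (card I) :: ennreal)"
        by (simp add: indicator_def of_bool_def I_def flip: sum.inter_filter)
      ultimately show ?thesis by simp
    qed
    then have "(\<Sum>i. indicator (f ` P i) w) \<le> (of_nat N :: ennreal)"
      by (intro suminf_le_const) auto
    then show "(\<Sum>i. h w * indicator (f ` P i) w) \<le> of_nat N * h w"
      by (simp add: mult.commute[of _ "h w"] mult_left_mono)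
  qed
  also have "\<dots> = of_nat N * (\<integral>\<^sup>+w. h w \<partial>lborel)"
    by (rule nn_integral_cmult) measurable
  finally show ?thesis .
qed

section \<open>Maximum modulus, order and number of preimages\<close>

lemma norm_le_max_modulus_cball:
  assumes hol: "f holomorphic_on UNIV" and z: "norm z \<le> r"
  shows "norm (f z) \<le> max_modulus f r"
proof (rule maximum_modulus_frontier[of f "cball 0 r"])
  show "f holomorphic_on interior (cball 0 r)" "continuous_on (closure (cball 0 r)) f"
    using hol holomorphic_on_subset holomorphic_on_imp_continuous_on by blast+
  show "norm (f w) \<le> max_modulus f r" if "w \<in> frontier (cball 0 r)" for w
    using that norm_le_max_modulus[OF hol, of w r] by simp
qed (use z in auto)

lemma max_modulus_mono:
  assumes "f holomorphic_on UNIV" "0 \<le> r" "r \<le> s"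
  shows "max_modulus f r \<le> max_modulus f s"
  unfolding max_modulus_def[of f r] using assms
  by (intro cSUP_least norm_le_max_modulus_cball) auto

text \<open>
  A form of Jensen's inequality. Division by a factor \<open>1 - z/a\<close> with \<open>\<bar>a\<bar> \<le> r\<close> removes the zero \<open>a\<close>,
  keeps the value at \<open>0\<close>, and lowers the maximum on \<open>\<bar>z\<bar> = 4r\<close> by a factor \<open>3\<close> because
  \<open>\<bar>1 - z/a\<bar> \<ge> 4 - 1\<close> there.
\<close>
lemma norm_at_zero_le_of_zeros:
  assumes Z: "finite Z" "Z \<subseteq> cball 0 r" and r: "r > 0"
    and hol: "g holomorphic_on UNIV" and zero: "\<And>a. a \<in> Z \<Longrightarrow> g a = 0" and g0: "g 0 \<noteq> 0"
    and B: "\<And>z. norm z = 4 * r \<Longrightarrow> norm (g z) \<le> B"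
  shows "3 ^ card Z * norm (g 0) \<le> B"
  using Z hol zero g0 B
proof (induction Z arbitrary: g B rule: finite_induct)
  case empty
  have "norm (g 0) \<le> B"
  proof (rule maximum_modulus_frontier[of g "cball 0 (4 * r)"])
    show "g holomorphic_on interior (cball 0 (4 * r))" "continuous_on (closure (cball 0 (4 * r))) g"
      using empty(2) holomorphic_on_subset holomorphic_on_imp_continuous_on by blast+
  qed (use r empty in auto)
  then show ?case by simp
next
  case (insert a Z)
  have ga: "g a = 0" and a: "norm a \<le> r" "a \<noteq> 0" using insert.prems by auto
  define g' where "g' z = - a * (if z = a then deriv g a else (g z - g a) / (z - a))" for z
  have "g' holomorphic_on UNIV"
    unfolding g'_def using insert.prems(2)
    by (intro holomorphic_on_mult holomorphic_on_const pole_lemma) auto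
  moreover have "g' b = 0" if "b \<in> Z" for b
    using that insert.prems(3) insert.hyps ga by (auto simp: g'_def)
  moreover have g'0: "g' 0 = g 0" using a ga by (simp add: g'_def)
  moreover have "norm (g' z) \<le> B / 3" if z: "norm z = 4 * r" for z
  proof -
    have "3 * r \<le> norm (z - a)" using norm_triangle_ineq2[of z a] z a by linarith
    moreover have "z \<noteq> a" using z a r by auto
    moreover have "norm (g z) \<le> B" using insert.prems(5) z by blast
    ultimately have "norm a * norm (g z) * 3 \<le> B * norm (z - a)"
    proof -
      have "norm a * norm (g z) * 3 \<le> r * B * 3"
        using a(1) \<open>norm (g z) \<le> B\<close> r by (intro mult_right_mono mult_mono) auto
      also have "\<dots> = B * (3 * r)" by simp
      also have "\<dots> \<le> B * norm (z - a)"
        using \<open>3 * r \<le> norm (z - a)\<close> order_trans[OF norm_ge_zero \<open>norm (g z) \<le> B\<close>]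
        by (intro mult_left_mono)
      finally show ?thesis .
    qed
    then show ?thesis
      using \<open>z \<noteq> a\<close> ga by (simp add: g'_def norm_mult norm_divide field_simps)
  qed
  ultimately have "3 ^ card Z * norm (g' 0) \<le> B / 3"
    using insert.prems(1,4) by (intro insert.IH) auto
  then show ?case using insert.hyps g'0 by simp
qed

text \<open>
  The bound is uniform in \<open>w\<close>: a value \<open>w\<close> that is attained in the disc satisfies \<open>\<bar>w\<bar> \<le> M(4r, f)\<close>, so
  \<open>f - w\<close> is at most \<open>2 M(4r, f)\<close> on the circle of radius \<open>4r\<close>. Since \<open>\<bar>w - f 0\<bar> \<ge> 1\<close> and \<open>ln 3 \<ge> 1\<close>,
  the Jensen inequality above counts the zeros.
\<close>
lemma card_preimages_le_ln_max_modulus: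
  assumes hol: "f holomorphic_on UNIV" and r: "r > 0"
    and M: "max_modulus f (4 * r) \<ge> 1" and w: "norm (w - f 0) \<ge> 1"
  shows "finite {z \<in> cball 0 r. f z = w}"
    and "real (card {z \<in> cball 0 r. f z = w}) \<le> ln (2 * max_modulus f (4 * r))"
proof -
  define B where "B = 2 * max_modulus f (4 * r)"
  have B: "B \<ge> 2" using M by (simp add: B_def)
  have bound: "real (card Z) \<le> ln B" if Z: "Z \<subseteq> {z \<in> cball 0 r. f z = w}" "finite Z" for Z
  proof (cases "Z = {}")
    case True
    then show ?thesis using B by simp
  next
    case False
    then obtain a where "norm a \<le> r" "f a = w" using Z by auto
    then have wM: "norm w \<le> max_modulus f (4 * r)"
      using norm_le_max_modulus_cball[OF hol, of a "4 * r"] r by simp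
    have "3 ^ card Z * norm (f 0 - w) \<le> B"
    proof (rule norm_at_zero_le_of_zeros[OF Z(2) _ r])
      show "norm (f z - w) \<le> B" if "norm z = 4 * r" for z
        using norm_triangle_ineq4[of "f z" w] wM norm_le_max_modulus[OF hol that] by (simp add: B_def)
    qed (use Z w hol in \<open>auto intro!: holomorphic_intros\<close>)
    moreover have "norm (f 0 - w) \<ge> 1" using w by (simp add: norm_minus_commute)
    then have "3 ^ card Z * 1 \<le> 3 ^ card Z * norm (f 0 - w)" by (intro mult_left_mono) auto
    ultimately have "3 ^ card Z \<le> B" by linarith
    then have "ln (3 ^ card Z) \<le> ln B" by (subst ln_le_cancel_iff) (use B in auto)
    then have "real (card Z) * ln 3 \<le> ln B" by (simp add: ln_realpow)
    moreover have "ln (3::real) \<ge> 1"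
      using exp_le by (subst ln_ge_iff) auto
    ultimately show ?thesis using mult_left_mono[of 1 "ln 3" "real (card Z)"] by simp
  qed
  have "finite {z \<in> cball 0 r. f z = w} \<and> card {z \<in> cball 0 r. f z = w} \<le> nat \<lfloor>ln B\<rfloor>"
    using bound by (intro finite_if_finite_subsets_card_bdd) (simp add: le_nat_floor)
  then show fin: "finite {z \<in> cball 0 r. f z = w}" by simp
  show "real (card {z \<in> cball 0 r. f z = w}) \<le> ln (2 * max_modulus f (4 * r))"
    using bound[OF order_refl fin] by (simp add: B_def)
qed

lemma entire_order_nonneg:
  assumes order: "entire_order f = ereal \<rho>" and R: "\<forall>r\<ge>R. max_modulus f r > r"
  shows "\<rho> \<ge> 0"
proof -
  have "eventually (\<lambda>r. 0 \<le> ereal (ln (ln (max_modulus f r)) / ln r)) at_top"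
    using eventually_ge_at_top[of R] eventually_ge_at_top[of 3]
  proof eventually_elim
    case (elim r)
    have "ln r \<ge> 1" using elim exp_le by (subst ln_ge_iff) auto
    moreover have "ln r \<le> ln (max_modulus f r)"
      using R elim by (subst ln_le_cancel_iff) (auto intro: less_imp_le less_trans[of 0 r])
    ultimately show ?case by auto
  qed
  then have "0 \<le> entire_order f"
    unfolding entire_order_def by (intro le_Limsup) auto
  then show ?thesis using order by simp
qed

lemma max_modulus_le_exp_powr:
  assumes order: "entire_order f = ereal \<rho>" and R: "\<forall>r\<ge>R. max_modulus f r > r"
    and K: "\<rho> < K"
  shows "eventually (\<lambda>r. max_modulus f r \<le> exp (r powr K)) at_top"
proof -
  have "Limsup at_top (\<lambda>r. ereal (ln (ln (max_modulus f r)) / ln r)) < ereal K"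
    using order K by (simp add: entire_order_def)
  then have "eventually (\<lambda>r. ereal (ln (ln (max_modulus f r)) / ln r) < ereal K) at_top"
    by (rule Limsup_lessD)
  then show ?thesis
    using eventually_ge_at_top[of R] eventually_ge_at_top[of 3]
  proof eventually_elim
    case (elim r)
    have r: "ln r \<ge> 1" using elim exp_le by (subst ln_ge_iff) auto
    have M: "max_modulus f r > r" using R elim by auto
    have "ln r \<le> ln (max_modulus f r)"
      using M elim by (subst ln_le_cancel_iff) auto
    then have lM: "ln (max_modulus f r) > 0" using r by simp
    have "ln (ln (max_modulus f r)) \<le> K * ln r"
      using elim r by (simp add: field_simps)
    then have "ln (max_modulus f r) \<le> exp (K * ln r)"
      using lM by (metis exp_le_cancel_iff exp_ln)
    also have "\<dots> = r powr K" using elim by (simp add: powr_def)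
    finally show ?case using M elim by (metis exp_le_cancel_iff exp_ln less_trans zero_less_numeral order_less_le_trans)
  qed
qed

text \<open>
  Write \<open>x n = exp s\<close> and compare with \<open>M\<^sup>j(R, f) \<le> exp t\<close>, where \<open>t\<close> runs through the iterates of
  \<open>t \<mapsto> exp (K t)\<close>. The induction must carry the stronger bound \<open>s \<ge> c t\<close>: with \<open>\<epsilon> c \<ge> K + 1\<close> one gets
  \<open>exp (\<epsilon> s) \<ge> exp t * exp (K t)\<close>, and \<open>exp t \<ge> c\<close> restores the factor \<open>c\<close> as soon as \<open>t \<ge> c\<close>.
\<close>
lemma iterates_exceed_max_modulus:
  fixes x :: "nat \<Rightarrow> real"
  assumes hol: "f holomorphic_on UNIV" and R: "R > 0" "\<forall>r\<ge>R. max_modulus f r > r"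
    and M: "eventually (\<lambda>r. max_modulus f r \<le> exp (r powr K)) at_top"
    and eps: "\<epsilon> > 0" and x: "\<And>n. x (Suc n) \<ge> exp (x n powr \<epsilon>)" "filterlim x at_top sequentially"
  shows "\<exists>L. \<forall>n>L. x n \<ge> (max_modulus f ^^ (n - L)) R"
proof -
  obtain r1 where r1: "\<And>r. r \<ge> r1 \<Longrightarrow> max_modulus f r \<le> exp (r powr K)"
    using M by (auto simp: eventually_at_top_linorder)
  \<comment> \<open>With an exponent of at least \<open>1\<close> the comparison sequence \<open>t\<close> is increasing.\<close>
  define K1 where "K1 = max 1 K"
  define c where "c = max 1 ((K1 + 1) / \<epsilon>)"
  have c: "c \<ge> 1" "\<epsilon> * c \<ge> K1 + 1" and K1: "K1 \<ge> 1" "K1 \<ge> K"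
    using eps by (auto simp: c_def K1_def max_def field_simps)
  define t0 where "t0 = max (max c r1) R"
  have t0: "t0 \<ge> c" "t0 \<ge> 1" "exp t0 \<ge> r1" "exp t0 \<ge> R"
    using c exp_ge_add_one_self[of t0] by (auto simp: t0_def simp del: exp_ge_add_one_self)
  define t where "t j = ((\<lambda>s. exp (K1 * s)) ^^ j) t0" for j
  have t_Suc: "t (Suc j) = exp (K1 * t j)" for j by (simp add: t_def)
  have t_ge: "t j \<ge> t0" for j
  proof (induction j)
    case (Suc j)
    have "t j \<le> K1 * t j" using K1 t0 Suc by (simp add: mult_le_cancel_right1)
    also have "\<dots> \<le> exp (K1 * t j)" using exp_ge_add_one_self[of "K1 * t j"] by linarith
    finally show ?case using Suc t_Suc by simp
  qed (simp add: t_def)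
  have iter: "R \<le> (max_modulus f ^^ j) R \<and> (max_modulus f ^^ j) R \<le> exp (t j)" for j
  proof (induction j)
    case 0
    then show ?case using t0 by (simp add: t_def)
  next
    case (Suc j)
    have "max_modulus f ((max_modulus f ^^ j) R) \<le> max_modulus f (exp (t j))"
      using Suc R by (intro max_modulus_mono hol) auto
    also have "\<dots> \<le> exp (exp (t j) powr K)"
      using t_ge[of j] t0 by (intro r1 order_trans[OF t0(3)]) auto
    also have "exp (t j) powr K \<le> t (Suc j)"
      using K1 t_ge[of j] t0 by (simp add: powr_def t_Suc mult_right_mono)
    finally show ?case using Suc R(2) by (auto intro: order_trans less_imp_le)
  qed
  obtain n0 where n0: "x n0 \<ge> exp (c * t0)"
    using x(2) by (auto simp: filterlim_at_top eventually_sequentially)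
  have xt: "x (n0 + j) \<ge> exp (c * t j)" for j
  proof (induction j)
    case 0
    then show ?case using n0 by (simp add: t_def)
  next
    case (Suc j)
    have "c \<le> exp (t j)"
      using t_ge[of j] t0(1) exp_ge_add_one_self[of "t j"] by linarith
    then have "c * t (Suc j) \<le> exp (t j) * exp (K1 * t j)"
      by (simp add: t_Suc)
    also have "\<dots> = exp ((K1 + 1) * t j)" by (simp add: algebra_simps flip: exp_add)
    also have "\<dots> \<le> exp (\<epsilon> * c * t j)"
      using c t_ge[of j] t0 by (simp add: mult_right_mono)
    also have "\<dots> = exp (c * t j) powr \<epsilon>" by (simp add: powr_def mult_ac)
    also have "\<dots> \<le> x (n0 + j) powr \<epsilon>"
      using Suc eps by (intro powr_mono2) auto
    finally have "exp (c * t (Suc j)) \<le> exp (x (n0 + j) powr \<epsilon>)" by simp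
    also have "\<dots> \<le> x (Suc (n0 + j))" by (rule x(1))
    finally show ?case by simp
  qed
  show ?thesis
  proof (intro exI[of _ n0] allI impI)
    fix n assume n: "n > n0"
    have "(max_modulus f ^^ (n - n0)) R \<le> exp (t (n - n0))" using iter by blast
    also have "\<dots> \<le> exp (c * t (n - n0))"
      using c t_ge[of "n - n0"] t0 by (simp add: mult_le_cancel_right1)
    also have "\<dots> \<le> x n" using xt[of "n - n0"] n by simp
    finally show "(max_modulus f ^^ (n - n0)) R \<le> x n" .
  qed
qed

section \<open>Escaping points in the Fatou set\<close>

lemma open_fatou_set: "open (fatou_set f)"
  unfolding fatou_set_def by (subst open_subopen) blast

text \<open>
  Pull a sequence of iterates on \<open>f ` ball z e\<close> back to the disc by composing with \<open>f\<close>. Any selection of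
  preimages in the closed disc turns the uniform limit found there into a uniform limit on the image.
\<close>
lemma fatou_set_forward_invariant:
  assumes hol: "f holomorphic_on UNIV" and nc: "\<not> f constant_on UNIV" and z: "z \<in> fatou_set f"
  shows "f z \<in> fatou_set f"
proof -
  obtain U where U: "open U" "z \<in> U" and norm: "normal_family_on U (range (\<lambda>n. f ^^ n))"
    using z by (auto simp: fatou_set_def)
  obtain e where e: "e > 0" "cball z e \<subseteq> U"
    using U open_contains_cball by blast
  define W where "W = f ` ball z e"
  have "open W"
    unfolding W_def by (rule open_mapping_thm[OF hol _ _ _ _ nc]) auto
  moreover have "f z \<in> W" using e by (auto simp: W_def)
  moreover have "normal_family_on W (range (\<lambda>n. f ^^ n))"
    unfolding normal_family_on_def
  proof (intro allI impI)
    fix h :: "nat \<Rightarrow> complex \<Rightarrow> complex"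
    assume h: "range h \<subseteq> range (\<lambda>n. f ^^ n)"
    define h' where "h' i = h i \<circ> f" for i
    have "h' i \<in> range (\<lambda>n. f ^^ n)" for i
    proof -
      obtain n where "h i = f ^^ n" using h by blast
      then have "h' i = f ^^ Suc n" by (simp add: h'_def funpow_Suc_right del: funpow.simps)
      then show ?thesis by blast
    qed
    then have "range h' \<subseteq> range (\<lambda>n. f ^^ n)" by blast
    then obtain k where k: "strict_mono k" and
      lim: "(\<exists>g. \<forall>K. compact K \<and> K \<subseteq> U \<longrightarrow> uniform_limit K (h' \<circ> k) g sequentially) \<or>
        (\<forall>K. compact K \<and> K \<subseteq> U \<longrightarrow>
           (\<forall>B. \<forall>\<^sub>F n in sequentially. \<forall>z\<in>K. norm (h' (k n) z) > B))"
      using norm unfolding normal_family_on_def by meson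
    define s where "s w = (SOME x. x \<in> cball z e \<and> f x = w)" for w
    have s: "s w \<in> cball z e" "f (s w) = w" if "w \<in> W" for w
    proof -
      have "\<exists>x. x \<in> cball z e \<and> f x = w"
        using that ball_subset_cball[of z e] unfolding W_def by blast
      from someI_ex[OF this] show "s w \<in> cball z e" "f (s w) = w" by (auto simp: s_def)
    qed
    show "\<exists>k. strict_mono k \<and>
        ((\<exists>g. \<forall>K. compact K \<and> K \<subseteq> W \<longrightarrow> uniform_limit K (h \<circ> k) g sequentially) \<or>
         (\<forall>K. compact K \<and> K \<subseteq> W \<longrightarrow>
            (\<forall>B. \<forall>\<^sub>F n in sequentially. \<forall>z\<in>K. norm (h (k n) z) > B)))"
    proof (intro exI[of _ k] conjI k)
      show "(\<exists>g. \<forall>K. compact K \<and> K \<subseteq> W \<longrightarrow> uniform_limit K (h \<circ> k) g sequentially) \<or>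
         (\<forall>K. compact K \<and> K \<subseteq> W \<longrightarrow>
            (\<forall>B. \<forall>\<^sub>F n in sequentially. \<forall>z\<in>K. norm (h (k n) z) > B))"
        using lim
      proof
        assume "\<exists>g. \<forall>K. compact K \<and> K \<subseteq> U \<longrightarrow> uniform_limit K (h' \<circ> k) g sequentially"
        then obtain g where g: "uniform_limit (cball z e) (h' \<circ> k) g sequentially"
          using e(2) compact_cball by blast
        have "uniform_limit K (h \<circ> k) (g \<circ> s) sequentially" if K: "K \<subseteq> W" for K
        proof (rule uniform_limitI)
          fix \<delta> :: real assume "\<delta> > 0"
          from uniform_limitD[OF g this]
          show "\<forall>\<^sub>F n in sequentially. \<forall>x\<in>K. dist ((h \<circ> k) n x) ((g \<circ> s) x) < \<delta>"
          proof eventually_elim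
            case (elim n)
            show ?case
            proof
              fix w assume "w \<in> K"
              then have w: "w \<in> W" using K by auto
              show "dist ((h \<circ> k) n w) ((g \<circ> s) w) < \<delta>"
                using bspec[OF elim s(1)[OF w]] s(2)[OF w] by (simp add: h'_def)
            qed
          qed
        qed
        then show ?thesis by blast
      next
        assume inf: "\<forall>K. compact K \<and> K \<subseteq> U \<longrightarrow>
           (\<forall>B. \<forall>\<^sub>F n in sequentially. \<forall>z\<in>K. norm (h' (k n) z) > B)"
        have "\<forall>\<^sub>F n in sequentially. \<forall>z\<in>K. norm (h (k n) z) > B" if K: "K \<subseteq> W" for K B
        proof -
          have "\<forall>\<^sub>F n in sequentially. \<forall>z\<in>cball z e. norm (h' (k n) z) > B"
            using inf e by auto
          then show ?thesis
          proof eventually_elim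
            case (elim n)
            show ?case
            proof
              fix w assume "w \<in> K"
              then have w: "w \<in> W" using K by auto
              show "norm (h (k n) w) > B"
                using bspec[OF elim s(1)[OF w]] s(2)[OF w] by (simp add: h'_def)
            qed
          qed
        qed
        then show ?thesis by blast
      qed
    qed
  qed
  ultimately show ?thesis by (auto simp: fatou_set_def)
qed

definition escaping_set :: "(complex \<Rightarrow> complex) \<Rightarrow> complex set" where
  "escaping_set f = {z. filterlim (\<lambda>n. (f ^^ n) z) at_infinity sequentially}"

lemma escaping_set_funpow_iff: "(f ^^ n) z \<in> escaping_set f \<longleftrightarrow> z \<in> escaping_set f"
proof -
  have "(f ^^ m) ((f ^^ n) z) = (f ^^ (m + n)) z" for m by (simp add: funpow_add)
  then show ?thesis
    unfolding escaping_set_def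
    by (simp add: filterlim_iff eventually_sequentially_seg[of "\<lambda>m. P ((f ^^ m) z)" n for P])
qed

text \<open>
  The two alternatives in the definition of normality exclude each other for a sequence of iterates
  that is unbounded at \<open>z\<close> and bounded at \<open>w\<close>.
\<close>
lemma escaping_on_normal_set:
  assumes U: "normal_family_on U (range (\<lambda>n. f ^^ n))" and z: "z \<in> U" "z \<in> escaping_set f" and w: "w \<in> U"
  shows "w \<in> escaping_set f"
proof (rule ccontr)
  assume "w \<notin> escaping_set f"
  then obtain B where "\<not> eventually (\<lambda>n. norm ((f ^^ n) w) > B) sequentially"
    unfolding escaping_set_def
    by (auto simp: filterlim_at_infinity_conv_norm_at_top filterlim_at_top_dense)
  from not_eventually_sequentiallyD[OF this]
  obtain q :: "nat \<Rightarrow> nat" where q: "strict_mono q" "\<And>i. \<not> norm ((f ^^ q i) w) > B" by auto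
  have "range (\<lambda>i. f ^^ q i) \<subseteq> range (\<lambda>n. f ^^ n)" by auto
  then obtain k where k: "strict_mono k" and
    lim: "(\<exists>g. \<forall>K. compact K \<and> K \<subseteq> U \<longrightarrow> uniform_limit K ((\<lambda>i. f ^^ q i) \<circ> k) g sequentially) \<or>
        (\<forall>K. compact K \<and> K \<subseteq> U \<longrightarrow>
           (\<forall>B. \<forall>\<^sub>F n in sequentially. \<forall>z\<in>K. norm ((f ^^ q (k n)) z) > B))"
    using U unfolding normal_family_on_def by meson
  from lim show False
  proof
    assume "\<exists>g. \<forall>K. compact K \<and> K \<subseteq> U \<longrightarrow> uniform_limit K ((\<lambda>i. f ^^ q i) \<circ> k) g sequentially"
    then obtain g where "uniform_limit {z} ((\<lambda>i. f ^^ q i) \<circ> k) g sequentially"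
      using z(1) by (metis compact_sing empty_subsetI insert_subset)
    then have "(\<lambda>n. (f ^^ q (k n)) z) \<longlonglongrightarrow> g z"
      using tendsto_uniform_limitI[where x = z and S = "{z}"] by fastforce
    moreover have "filterlim (\<lambda>n. (f ^^ q (k n)) z) at_infinity sequentially"
    proof -
      have "strict_mono (\<lambda>n. q (k n))" using q(1) k by (simp add: strict_mono_def)
      then show ?thesis
        using z(2) filterlim_compose[OF _ filterlim_subseq] by (auto simp: escaping_set_def)
    qed
    ultimately show False
      using not_tendsto_and_filterlim_at_infinity[of sequentially] by auto
  next
    assume inf: "\<forall>K. compact K \<and> K \<subseteq> U \<longrightarrow>
           (\<forall>B. \<forall>\<^sub>F n in sequentially. \<forall>z\<in>K. norm ((f ^^ q (k n)) z) > B)"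
    have "\<forall>\<^sub>F n in sequentially. norm ((f ^^ q (k n)) w) > B"
      using inf[rule_format, of "{w}" B] w by simp
    then have "\<forall>\<^sub>F n in sequentially. False" using q(2) by simp
    then show False by simp
  qed
qed

lemma escaping_on_fatou_component:
  assumes C: "C \<in> components (fatou_set f)" and z: "z \<in> C" "z \<in> escaping_set f" and w: "w \<in> C"
  shows "w \<in> escaping_set f"
proof -
  have "(z \<in> escaping_set f) = (w \<in> escaping_set f)"
  proof (rule connected_local_const[of C])
    show "\<forall>a\<in>C. eventually (\<lambda>b. (a \<in> escaping_set f) = (b \<in> escaping_set f)) (at a within C)"
    proof
      fix a assume "a \<in> C"
      then have "a \<in> fatou_set f" using C in_components_subset by blast
      then obtain U where U: "open U" "a \<in> U" "normal_family_on U (range (\<lambda>n. f ^^ n))"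
        by (auto simp: fatou_set_def)
      have "eventually (\<lambda>b. b \<in> U) (at a within C)"
        using U(1,2) eventually_at_topological by blast
      then show "eventually (\<lambda>b. (a \<in> escaping_set f) = (b \<in> escaping_set f)) (at a within C)"
        by eventually_elim (use U escaping_on_normal_set in blast)
    qed
  qed (use C z w in_components_connected in auto)
  then show ?thesis using z by simp
qed

lemma holomorphic_funpow:
  assumes "f holomorphic_on UNIV"
  shows "(f ^^ n) holomorphic_on (UNIV :: complex set)"
proof (induction n)
  case (Suc n)
  then show ?case
    unfolding funpow.simps(2)
    using holomorphic_on_compose[OF Suc] assms holomorphic_on_subset by blast
qed (simp add: id_def)

text \<open>
  The disc is mapped by \<open>f\<^sup>n\<close> into a Fatou component \<open>C\<close> of escaping points, which omits \<open>p\<close>. With a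
  branch \<open>L\<close> of \<open>log (w - p)\<close> on \<open>C\<close>, the function \<open>L \<circ> f\<^sup>n\<close> does not take two values that differ by
  \<open>2\<pi>\<i>\<close>, so its image contains no disc of radius greater than \<open>\<pi>\<close>. Bloch's theorem with the constant
  \<open>1/12\<close> bounds its derivative at \<open>z\<close> by \<open>12 \<pi> / d\<close>, and \<open>12 \<pi> < 48\<close>.
\<close>
lemma deriv_funpow_le_of_simply_connected:
  assumes hol: "f holomorphic_on UNIV" and nc: "\<not> f constant_on UNIV"
    and sc: "\<forall>C \<in> components (fatou_set f). simply_connected C"
    and d: "d > 0" "ball z d \<subseteq> fatou_set f"
    and z: "z \<in> escaping_set f" and p: "p \<notin> escaping_set f"
  shows "d * norm (deriv (f ^^ n) z) \<le> 48 * norm ((f ^^ n) z - p)"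
proof -
  have holn: "(f ^^ n) holomorphic_on UNIV" by (rule holomorphic_funpow[OF hol])
  have img: "(f ^^ m) ` ball z d \<subseteq> fatou_set f" for m
    by (induction m) (use d fatou_set_forward_invariant[OF hol nc] in auto)
  define C where "C = connected_component_set (fatou_set f) ((f ^^ n) z)"
  have C: "C \<in> components (fatou_set f)"
    using img[of n] d unfolding C_def by (intro componentsI) auto
  have imgC: "(f ^^ n) ` ball z d \<subseteq> C"
    unfolding C_def using img d
    by (intro connected_component_maximal connected_continuous_image)
       (auto intro: holomorphic_on_imp_continuous_on holomorphic_on_subset[OF holn])
  have openC: "open C" using open_components[OF open_fatou_set C] .
  have "(f ^^ n) z \<in> C" using imgC d by auto
  then have pC: "p \<notin> C"
    using escaping_on_fatou_component[OF C] escaping_set_funpow_iff z p by blast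
  obtain L where L: "L holomorphic_on C" "\<And>w. w \<in> C \<Longrightarrow> w - p = exp (L w)"
  proof (rule simply_connected_imp_holomorphic_log[of "\<lambda>w. w - p" C])
    show "locally path_connected C" using openC open_imp_locally_path_connected by blast
  qed (use sc C pC in \<open>auto intro!: holomorphic_intros\<close>)
  define G where "G = L \<circ> (f ^^ n)"
  have G: "G holomorphic_on ball z d"
    unfolding G_def using imgC
    by (intro holomorphic_on_compose_gen[OF holomorphic_on_subset[OF holn] L(1)]) auto
  have expG: "exp (G x) = (f ^^ n) x - p" if "x \<in> ball z d" for x
    unfolding G_def comp_def using imgC that by (intro L(2)[symmetric]) blast
  have zb: "z \<in> ball z d" using d by simp
  have "deriv G z * exp (G z) = deriv (f ^^ n) z"
  proof (rule DERIV_unique)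
    have "((\<lambda>x. exp (G x)) has_field_derivative deriv G z * exp (G z)) (at z)"
      using holomorphic_derivI[OF G open_ball zb] by (auto intro!: derivative_eq_intros)
    then show "((\<lambda>x. (f ^^ n) x - p) has_field_derivative deriv G z * exp (G z)) (at z)"
      by (rule has_field_derivative_transform_within_open[OF _ open_ball zb]) (rule expG)
    show "((\<lambda>x. (f ^^ n) x - p) has_field_derivative deriv (f ^^ n) z) (at z)"
      using holomorphic_derivI[OF holn open_UNIV UNIV_I] by (auto intro!: derivative_eq_intros)
  qed
  then have derivG: "norm (deriv G z) * norm ((f ^^ n) z - p) = norm (deriv (f ^^ n) z)"
    using expG[OF zb] by (metis norm_mult)
  have "d * norm (deriv G z) / 12 \<le> pi"
  proof (rule ccontr)
    assume "\<not> ?thesis"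
    then have gt: "d * norm (deriv G z) / 12 > pi" by simp
    obtain b where b: "ball b (d * norm (deriv G z) / 12) \<subseteq> G ` ball z d"
      using Bloch[OF G d(1) order_refl] .
    \<comment> \<open>The points \<open>b \<plusminus> \<pi>\<i>\<close> differ by a period of the exponential function.\<close>
    have in_ball: "b - \<i> * pi \<in> ball b (d * norm (deriv G z) / 12)"
      "b + \<i> * pi \<in> ball b (d * norm (deriv G z) / 12)"
      using gt by (auto simp: dist_norm norm_mult)
    obtain x1 where x1: "x1 \<in> ball z d" "b - \<i> * pi = G x1"
      using subsetD[OF b in_ball(1)] by (rule imageE)
    obtain x2 where x2: "x2 \<in> ball z d" "b + \<i> * pi = G x2"
      using subsetD[OF b in_ball(2)] by (rule imageE)
    note x = x1(1) x2(1) x1(2)[symmetric] x2(2)[symmetric]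
    have "exp (G x1) = exp (G x2)"
      unfolding x(3,4) by (simp add: exp_diff exp_add exp_pi_i exp_pi_i')
    then have "(f ^^ n) x1 = (f ^^ n) x2" using expG[OF x(1)] expG[OF x(2)] by simp
    then have "G x1 = G x2" by (simp add: G_def)
    then show False using x by simp
  qed
  then have "d * norm (deriv G z) \<le> 48" using pi_less_4 by simp
  then have "d * norm (deriv G z) * norm ((f ^^ n) z - p) \<le> 48 * norm ((f ^^ n) z - p)"
    by (intro mult_right_mono) auto
  then show ?thesis using derivG by (simp add: mult.assoc)
qed

text \<open>
  A fixed point of \<open>f \<circ> f\<close>, provided by Picard's theorem, has a bounded orbit.
\<close>
lemma ex_nonescaping_point:
  assumes hol: "f holomorphic_on UNIV" and non: "\<And>a. f \<noteq> (\<lambda>z. a + z)"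
  shows "\<exists>p. p \<notin> escaping_set f"
proof -
  obtain p where p: "f (f p) = p" using holomorphic_involution_point[OF hol non] .
  have "(f ^^ (2 * n)) p = p" for n
    by (induction n) (use p in auto)
  then have const: "(\<lambda>n. (f ^^ (2 * n)) p) \<longlonglongrightarrow> p" by simp
  have "p \<notin> escaping_set f"
  proof
    assume "p \<in> escaping_set f"
    then have "filterlim (\<lambda>n. (f ^^ (2 * n)) p) at_infinity sequentially"
      unfolding escaping_set_def
      using filterlim_compose[OF _ filterlim_subseq[of "\<lambda>n. 2 * n"]] by (auto simp: strict_mono_def)
    then show False using const not_tendsto_and_filterlim_at_infinity[of sequentially] by auto
  qed
  then show ?thesis by blast
qed

text \<open>
  By the chain rule, \<open>\<bar>z (f\<^sup>n)'(z) / f\<^sup>n(z)\<bar>\<close> is a product of \<open>n\<close> factors that are at least \<open>2\<close>. In the Fatou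
  set this quotient would be bounded, by the preceding estimate and because
  \<open>\<bar>f\<^sup>n(z) - p\<bar> \<le> 2 \<bar>f\<^sup>n(z)\<bar>\<close> for large \<open>n\<close>.
\<close>
lemma expanding_orbit_in_julia_set:
  assumes hol: "f holomorphic_on UNIV" and nl: "\<nexists>a b. \<forall>z. f z = a * z + b"
    and sc: "\<forall>C \<in> components (fatou_set f). simply_connected C"
    and z: "z \<in> escaping_set f"
    and expand: "\<And>n. let w = (f ^^ n) z in norm (w * deriv f w / f w) \<ge> 2"
  shows "z \<in> julia_set f"
proof (rule ccontr)
  assume "z \<notin> julia_set f"
  then have "z \<in> fatou_set f" by (simp add: julia_set_def)
  then obtain d where d: "d > 0" "ball z d \<subseteq> fatou_set f"
    using open_fatou_set open_contains_ball by blast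
  have nc: "\<not> f constant_on UNIV"
    using nl unfolding constant_on_def by (metis UNIV_I add_0 mult_zero_left)
  have "f \<noteq> (\<lambda>z. a + z)" for a
    using nl by (metis add.commute mult_1)
  then obtain p where p: "p \<notin> escaping_set f"
    using ex_nonescaping_point[OF hol] by blast
  have growth: "2 ^ n * norm ((f ^^ n) z) \<le> norm z * norm (deriv (f ^^ n) z)" for n
  proof (induction n)
    case 0
    then show ?case by (simp add: id_def)
  next
    case (Suc n)
    define w where "w = (f ^^ n) z"
    have ex: "norm (w * deriv f w / f w) \<ge> 2" using expand[of n] by (simp add: w_def Let_def)
    then have fw: "f w \<noteq> 0" by auto
    have "deriv (f ^^ Suc n) z = deriv f w * deriv (f ^^ n) z"
      unfolding w_def using deriv_chain[of "f ^^ n" z f] hol holomorphic_funpow[OF hol, of n]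
      by (simp add: holomorphic_on_imp_differentiable_at[OF _ open_UNIV])
    then have eq: "norm z * norm (deriv (f ^^ Suc n) z) = norm (deriv f w) * (norm z * norm (deriv (f ^^ n) z))"
      by (simp add: norm_mult)
    have "2 ^ n * (norm w * norm (deriv f w)) = norm (deriv f w) * (2 ^ n * norm w)"
      by simp
    also have "\<dots> \<le> norm z * norm (deriv (f ^^ Suc n) z)"
      unfolding eq using Suc by (intro mult_left_mono) (auto simp: w_def)
    finally have "2 ^ n * (norm w * norm (deriv f w)) \<le> norm z * norm (deriv (f ^^ Suc n) z)" .
    moreover have "norm w * norm (deriv f w) \<ge> 2 * norm (f w)"
      using ex fw by (simp add: norm_mult norm_divide field_simps)
    then have "2 ^ n * (2 * norm (f w)) \<le> 2 ^ n * (norm w * norm (deriv f w))"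
      by (intro mult_left_mono) auto
    ultimately have "2 ^ n * (2 * norm (f w)) \<le> norm z * norm (deriv (f ^^ Suc n) z)"
      by (rule order_trans[rotated])
    moreover have "(f ^^ Suc n) z = f w" by (simp add: w_def)
    ultimately show ?case by (simp only: power_Suc mult_ac)
  qed
  have "filterlim (\<lambda>n. norm ((f ^^ n) z)) at_top sequentially"
    using z by (simp add: escaping_set_def filterlim_at_infinity_imp_norm_at_top)
  then have "eventually (\<lambda>n. norm ((f ^^ n) z) \<ge> norm p + 1) sequentially"
    by (simp add: filterlim_at_top)
  moreover have "eventually (\<lambda>n. (2::real) ^ n > 96 * norm z / d) sequentially"
  proof -
    have "filterlim (\<lambda>n. (2::real) ^ n) at_top sequentially" by real_asymp
    then show ?thesis by (simp add: filterlim_at_top_dense)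
  qed
  ultimately have "eventually (\<lambda>n::nat. False) sequentially"
  proof eventually_elim
    case (elim n)
    define w where "w = (f ^^ n) z"
    have w: "norm w > 0" "norm (w - p) \<le> 2 * norm w"
      using elim(1) norm_triangle_ineq4[of w p] norm_ge_zero[of p] unfolding w_def[symmetric] by linarith+
    have "d * (2 ^ n * norm w) \<le> d * (norm z * norm (deriv (f ^^ n) z))"
      using growth[of n] d by (intro mult_left_mono) (auto simp: w_def)
    also have "\<dots> = norm z * (d * norm (deriv (f ^^ n) z))" by simp
    also have "\<dots> \<le> norm z * (48 * norm (w - p))"
      unfolding w_def using deriv_funpow_le_of_simply_connected[OF hol nc sc d z p]
      by (intro mult_left_mono) auto
    also have "\<dots> \<le> norm z * (48 * (2 * norm w))"
      using w by (intro mult_left_mono) auto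
    finally have "d * 2 ^ n \<le> 96 * norm z" using w(1) by simp
    then have "2 ^ n \<le> 96 * norm z / d" using d by (simp add: field_simps)
    then show False using elim(2) by simp
  qed
  then show False by simp
qed

section \<open>Logarithmic area\<close>

abbreviation log_measure :: "complex measure" where
  "log_measure \<equiv> density lborel (\<lambda>z. ennreal (1 / (norm z)\<^sup>2))"

lemma logarea_eq_nn_integral:
  assumes "A \<in> sets borel"
  shows "logarea A = (\<integral>\<^sup>+z\<in>A. ennreal (1 / (norm z)\<^sup>2) \<partial>lborel)"
  using assms unfolding logarea_def by (subst nn_integral_completion) auto

lemma logarea_eq_emeasure:
  assumes "A \<in> sets borel"
  shows "logarea A = emeasure log_measure A"
  using assms by (simp add: logarea_eq_nn_integral emeasure_density)

lemma logarea_mono: "A \<subseteq> B \<Longrightarrow> logarea A \<le> logarea B"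
  unfolding logarea_def by (intro nn_integral_mono) (auto split: split_indicator)

lemma Delta_borel [measurable]: "Delta \<in> sets borel"
  unfolding Delta_def by measurable

text \<open>
  The squares \<open>Q k\<close> with lower left corner \<open>2\<^sup>k\<close> and side \<open>2\<^sup>k\<close> are disjoint and arise from each other by
  dilation, which preserves logarithmic area; each has logarithmic area at least \<open>1/5\<close>.
\<close>
lemma logarea_Delta: "logarea Delta = \<infinity>"
proof (rule ccontr)
  assume "logarea Delta \<noteq> \<infinity>"
  then obtain L where L: "logarea Delta = ennreal L" "L \<ge> 0"
    by (cases "logarea Delta" rule: ennreal_cases) auto
  define Q :: "nat \<Rightarrow> complex set" where "Q k = box (Complex (2 ^ k) 0) (Complex (2 ^ Suc k) (2 ^ k))" for k
  have Q: "z \<in> Q k \<longleftrightarrow> 2 ^ k < Re z \<and> Re z < 2 ^ Suc k \<and> 0 < Im z \<and> Im z < 2 ^ k" for z k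
    by (auto simp: Q_def mem_box Basis_complex_def)
  have area_Q: "emeasure lborel (Q k) = ennreal (4 ^ k)" for k
    unfolding Q_def
    by (subst emeasure_lborel_box) (auto simp: Basis_complex_def simp flip: power_mult_distrib)
  have logarea_Q: "logarea (Q k) \<ge> ennreal (1 / 5)" for k
  proof -
    have "ennreal (1 / 5) = ennreal (1 / (5 * 4 ^ k)) * emeasure lborel (Q k)"
      by (simp add: area_Q flip: ennreal_mult)
    also have "\<dots> = (\<integral>\<^sup>+z\<in>Q k. ennreal (1 / (5 * 4 ^ k)) \<partial>lborel)"
      by (simp add: nn_integral_cmult_indicator Q_def)
    also have "\<dots> \<le> (\<integral>\<^sup>+z\<in>Q k. ennreal (1 / (norm z)\<^sup>2) \<partial>lborel)"
    proof (intro nn_integral_mono)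
      fix z
      have "ennreal (1 / (5 * 4 ^ k)) \<le> ennreal (1 / (norm z)\<^sup>2)" if z: "z \<in> Q k"
      proof -
      have "(Re z)\<^sup>2 \<le> (2 ^ Suc k)\<^sup>2" "(Im z)\<^sup>2 \<le> (2 ^ k)\<^sup>2"
        using z[unfolded Q] order_trans[of 0 "2 ^ k" "Re z"] by (intro power_mono; simp)+
      moreover have "(2 ^ Suc k)\<^sup>2 = 4 * (4::real) ^ k" "(2 ^ k)\<^sup>2 = (4::real) ^ k"
        by (simp_all add: power2_eq_square flip: power_mult_distrib)
      ultimately have "(norm z)\<^sup>2 \<le> 5 * 4 ^ k" using cmod_power2[of z] by linarith
      moreover have "z \<noteq> 0" using z[unfolded Q] by auto
      ultimately show ?thesis by (intro ennreal_leI divide_left_mono) auto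
      qed
      then show "ennreal (1 / (5 * 4 ^ k)) * indicator (Q k) z
          \<le> ennreal (1 / (norm z)\<^sup>2) * indicator (Q k) z"
        by (auto split: split_indicator)
    qed
    finally show ?thesis by (simp add: logarea_eq_nn_integral Q_def)
  qed
  have disj: "disjoint_family Q"
  proof -
    have "Q j \<inter> Q k = {}" if "j < k" for j k
    proof -
      have "(2::real) ^ Suc j \<le> 2 ^ k" using that by (intro power_increasing) auto
      then show ?thesis by (auto simp: Q)
    qed
    then show ?thesis unfolding disjoint_family_on_def by (metis Int_commute linorder_neqE_nat)
  qed
  have sub: "(\<Union>k<n. Q k) \<subseteq> Delta" for n
  proof (safe)
    fix z k assume "z \<in> Q k"
    then have "2 ^ k < Re z" by (simp add: Q)
    moreover have "(1::real) \<le> 2 ^ k" by simp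
    ultimately have "1 \<le> Re z" by linarith
    then show "z \<in> Delta" using complex_Re_le_cmod[of z] by (simp add: Delta_def)
  qed
  have Qb [measurable]: "Q k \<in> sets borel" for k by (simp add: Q_def)
  have bound: "real n * (1 / 5) \<le> L" for n
  proof -
    have "ennreal (real n * (1 / 5)) = ennreal (\<Sum>k<n. 1 / 5)" by simp
    also have "\<dots> = (\<Sum>k<n. ennreal (1 / 5))" by (rule sum_ennreal[symmetric]) simp
    also have "\<dots> \<le> (\<Sum>k<n. logarea (Q k))" by (intro sum_mono logarea_Q)
    also have "\<dots> = (\<Sum>k<n. emeasure log_measure (Q k))" by (simp add: logarea_eq_emeasure)
    also have "\<dots> = emeasure log_measure (\<Union>k<n. Q k)"
      using disj by (intro sum_emeasure) (auto simp: disjoint_family_on_def)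
    also have "\<dots> \<le> emeasure log_measure Delta"
      by (intro emeasure_mono sub) simp
    finally show ?thesis using L by (simp add: logarea_eq_emeasure)
  qed
  obtain n where "5 * L < real n" using reals_Archimedean2 by blast
  then show False using bound[of n] by linarith
qed

lemma logarea_Delta_ball_finite:
  assumes "r > 0"
  shows "logarea (Delta \<inter> ball 0 r) < \<infinity>"
proof -
  have "logarea (Delta \<inter> ball 0 r) = (\<integral>\<^sup>+z\<in>Delta \<inter> ball 0 r. ennreal (1 / (norm z)\<^sup>2) \<partial>lborel)"
    by (rule logarea_eq_nn_integral) measurable
  also have "\<dots> \<le> (\<integral>\<^sup>+z. 1 * indicator (ball 0 r) z \<partial>(lborel :: complex measure))"
    by (intro nn_integral_mono) (auto split: split_indicator simp: Delta_def divide_le_eq_1 one_le_power)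
  also have "\<dots> < \<infinity>" using emeasure_lborel_ball_finite[of "0 :: complex" r] by simp
  finally show ?thesis .
qed

lemma area_pos_if_logarea_cofinite:
  assumes Y: "Y \<in> sets borel" and fin: "logarea (Delta - Y) < \<infinity>"
  shows "area Y > 0"
proof (rule ccontr)
  assume "\<not> area Y > 0"
  then have "emeasure lborel Y = 0" using Y by simp
  then have "Y \<in> null_sets lborel" using Y by auto
  then have "Delta \<inter> Y \<in> null_sets lborel" by (intro null_set_Int1) auto
  then have "emeasure log_measure (Delta \<inter> Y) = 0"
    by (subst emeasure_density) (auto simp: nn_integral_null_set)
  then have "emeasure log_measure Delta \<le> emeasure log_measure (Delta - Y)"
    using emeasure_subadditive[of "Delta - Y" log_measure "Delta \<inter> Y"] Y
    by (simp add: Un_Diff_Int Diff_Int_distrib2)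
  then show False using logarea_Delta fin Y by (simp add: logarea_eq_emeasure)
qed

section \<open>Orbits that avoid the exceptional set\<close>

text \<open>
  On \<open>S\<close> the logarithmic area element \<open>\<bar>dz\<bar>\<^sup>2 / \<bar>z\<bar>\<^sup>2\<close> is that of the image, \<open>\<bar>f'\<bar>\<^sup>2 \<bar>dz\<bar>\<^sup>2 / \<bar>f\<bar>\<^sup>2\<close>,
  divided by \<open>\<bar>z f' / f\<bar>\<^sup>2 \<ge> s powr (2 a)\<close>. The number of preimages in the disc of radius \<open>2 s\<close> bounds
  the multiplicity.
\<close>
lemma logarea_preimage_annulus_le:
  assumes hol: "f holomorphic_on UNIV" and B: "B \<in> sets borel"
    and Bfar: "\<And>w. w \<in> B \<Longrightarrow> norm (w - f 0) \<ge> 1"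
    and s: "s \<ge> 1" and M: "max_modulus f (8 * s) \<ge> 1"
    and a: "a \<ge> 0"
    and S: "S = {z. s \<le> norm z \<and> norm z < 2 * s \<and> norm (z * deriv f z / f z) \<ge> norm z powr a \<and> f z \<in> B}"
  shows "logarea S \<le> ennreal (ln (2 * max_modulus f (8 * s)) * s powr (- 2 * a)) * logarea B"
proof -
  have [measurable]: "f \<in> borel_measurable borel" "deriv f \<in> borel_measurable borel"
    using hol by (auto intro!: borel_measurable_entire holomorphic_deriv)
  have [measurable]: "B \<in> sets borel" by (fact B)
  have Sb [measurable]: "S \<in> sets borel" unfolding S by measurable
  \<comment> \<open>\<open>ln (2 M(8s))\<close> is the bound for the number of preimages in the disc of radius \<open>2s\<close>.\<close>
  define N where "N = nat \<lfloor>ln (2 * max_modulus f (8 * s))\<rfloor>"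
  define h where "h w = ennreal (1 / (norm w)\<^sup>2) * indicator B w" for w :: complex
  have [measurable]: "h \<in> borel_measurable borel" unfolding h_def by measurable
  have int_h: "(\<integral>\<^sup>+w. h w \<partial>lborel) = logarea B"
    by (simp add: logarea_eq_nn_integral B h_def)
  have count: "finite {z \<in> S. f z = w} \<and> card {z \<in> S. f z = w} \<le> N" for w
  proof (cases "w \<in> B")
    case True
    have "max_modulus f (4 * (2 * s)) \<ge> 1" "2 * s > 0" using M s by auto
    note P = card_preimages_le_ln_max_modulus[OF hol this(2,1) Bfar[OF True]]
    have sub: "{z \<in> S. f z = w} \<subseteq> {z \<in> cball 0 (2 * s). f z = w}" by (auto simp: S)
    have "card {z \<in> cball 0 (2 * s). f z = w} \<le> N"
      unfolding N_def using P(2) by (intro le_nat_floor) simp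
    then show ?thesis using card_mono[OF P(1) sub] finite_subset[OF sub P(1)] by simp
  next
    case False
    then have "{z \<in> S. f z = w} = {}" by (auto simp: S)
    then show ?thesis by (metis card.empty finite.emptyI le0)
  qed
  have pos: "norm (z * deriv f z / f z) > 0" if "z \<in> S" for z
  proof -
    have "norm z powr a > 0" "norm z powr a \<le> norm (z * deriv f z / f z)"
      using that s by (auto simp: S)
    then show ?thesis by linarith
  qed
  have "logarea S = (\<integral>\<^sup>+z\<in>S. ennreal (1 / (norm z)\<^sup>2) \<partial>lborel)"
    by (rule logarea_eq_nn_integral) measurable
  also have "\<dots> \<le> (\<integral>\<^sup>+z. ennreal (s powr (- 2 * a)) *
      (h (f z) * ennreal ((norm (deriv f z))\<^sup>2) * indicator S z) \<partial>lborel)"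
  proof (intro nn_integral_mono)
    fix z
    have "ennreal (1 / (norm z)\<^sup>2) \<le> ennreal (s powr (- 2 * a)) * (h (f z) * ennreal ((norm (deriv f z))\<^sup>2))"
      if z: "z \<in> S"
    proof -
      define q where "q = norm (z * deriv f z / f z)"
      have z': "s \<le> norm z" "f z \<in> B" "norm z powr a \<le> q" using z by (auto simp: S q_def)
      have fz: "f z \<noteq> 0" "norm z > 0" using pos[OF z] by auto
      have "s powr a \<le> q"
        using z'(1,3) s a powr_mono2[of a s "norm z"] by linarith
      then have "(s powr a)\<^sup>2 \<le> q\<^sup>2" by (intro power_mono) auto
      then have "1 \<le> s powr (- 2 * a) * q\<^sup>2"
        using s by (simp add: powr_minus field_simps power2_eq_square powr_add[symmetric])
      then have "1 / (norm z)\<^sup>2 \<le> s powr (- 2 * a) * q\<^sup>2 / (norm z)\<^sup>2"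
        by (intro divide_right_mono) auto
      also have "\<dots> = s powr (- 2 * a) * (1 / (norm (f z))\<^sup>2 * (norm (deriv f z))\<^sup>2)"
        using fz by (simp add: q_def norm_mult norm_divide power_mult_distrib power_divide)
      finally have "ennreal (1 / (norm z)\<^sup>2)
          \<le> ennreal (s powr (- 2 * a) * (1 / (norm (f z))\<^sup>2 * (norm (deriv f z))\<^sup>2))"
        by (rule ennreal_leI)
      then show ?thesis using z'(2) by (simp add: h_def flip: ennreal_mult)
    qed
    then show "ennreal (1 / (norm z)\<^sup>2) * indicator S z \<le> ennreal (s powr (- 2 * a)) *
      (h (f z) * ennreal ((norm (deriv f z))\<^sup>2) * indicator S z)"
      by (auto split: split_indicator)
  qed
  also have "\<dots> = ennreal (s powr (- 2 * a)) *
      (\<integral>\<^sup>+z\<in>S. h (f z) * ennreal ((norm (deriv f z))\<^sup>2) \<partial>lborel)"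
    by (rule nn_integral_cmult) measurable
  also have "\<dots> \<le> ennreal (s powr (- 2 * a)) * (of_nat N * (\<integral>\<^sup>+w. h w \<partial>lborel))"
    using count pos by (intro mult_left_mono nn_integral_image_multiplicity_le hol) (force, auto)
  also have "\<dots> = ennreal (s powr (- 2 * a)) * of_nat N * logarea B"
    by (simp add: int_h mult.assoc)
  also have "ennreal (s powr (- 2 * a)) * of_nat N = ennreal (real N * s powr (- 2 * a))"
    by (simp add: ennreal_mult ennreal_of_nat_eq_real_of_nat mult.commute)
  also have "\<dots> * logarea B \<le> ennreal (ln (2 * max_modulus f (8 * s)) * s powr (- 2 * a)) * logarea B"
    using M by (intro mult_right_mono ennreal_leI) (auto simp: N_def)
  finally show ?thesis .
qed

text \<open>
  With \<open>a = \<rho>/2 + \<epsilon>\<close> and \<open>ln (M(8s, f)) = O(s powr (\<rho> + \<epsilon>))\<close>, the factor for the annulus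
  \<open>s \<le> \<bar>z\<bar> < 2s\<close> is \<open>O(s powr (-\<epsilon>))\<close>. For \<open>s = 2\<^sup>k r\<close> these factors form a geometric series in \<open>k\<close> whose
  sum tends to \<open>0\<close> as \<open>r \<rightarrow> \<infinity>\<close>.
\<close>
lemma logarea_preimage_le_half:
  assumes hol: "f holomorphic_on UNIV" and R: "\<forall>r\<ge>R. max_modulus f r > r"
    and order: "entire_order f = ereal \<rho>" and eps: "\<epsilon> > 0"
  shows "eventually (\<lambda>r. \<forall>B\<in>sets borel. (\<forall>w\<in>B. norm (w - f 0) \<ge> 1) \<longrightarrow>
     logarea {z. r \<le> norm z \<and> norm (z * deriv f z / f z) \<ge> norm z powr (\<rho> / 2 + \<epsilon>) \<and> f z \<in> B}
       \<le> ennreal (1 / 2) * logarea B) at_top"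
proof -
  have rho: "\<rho> \<ge> 0" by (rule entire_order_nonneg[OF order R])
  define K where "K = \<rho> + \<epsilon>"
  define C where "C = 2 * 8 powr K"
  define q where "q = (2::real) powr (- \<epsilon>)"
  have q: "0 < q" "q < 1" using eps by (auto simp: q_def powr_less_one)
  have K: "K > 0" using rho eps by (simp add: K_def)
  obtain r1 where r1: "\<And>r. r \<ge> r1 \<Longrightarrow> max_modulus f r \<le> exp (r powr K)"
    using max_modulus_le_exp_powr[OF order R, of K] eps by (auto simp: eventually_at_top_linorder K_def)
  have "eventually (\<lambda>r. C * r powr (- \<epsilon>) / (1 - q) \<le> 1 / 2) at_top"
  proof -
    have "((\<lambda>r. C * r powr (- \<epsilon>) / (1 - q)) \<longlongrightarrow> C * 0 / (1 - q)) at_top"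
      using eps q by (intro tendsto_intros tendsto_neg_powr filterlim_ident) auto
    then have "eventually (\<lambda>r. C * r powr (- \<epsilon>) / (1 - q) < 1 / 2) at_top"
      by (intro order_tendstoD(2)) auto
    then show ?thesis by eventually_elim simp
  qed
  then show ?thesis
    using eventually_ge_at_top[of r1] eventually_ge_at_top[of R] eventually_ge_at_top[of 1]
  proof eventually_elim
    case (elim r)
    show ?case
    proof (intro ballI impI)
      fix B :: "complex set" assume B [measurable]: "B \<in> sets borel" and Bfar: "\<forall>w\<in>B. norm (w - f 0) \<ge> 1"
      define S where "S s = {z. s \<le> norm z \<and> norm z < 2 * s \<and>
        norm (z * deriv f z / f z) \<ge> norm z powr (\<rho> / 2 + \<epsilon>) \<and> f z \<in> B}" for s
      have [measurable]: "f \<in> borel_measurable borel" "deriv f \<in> borel_measurable borel"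
        using hol by (auto intro!: borel_measurable_entire holomorphic_deriv)
      have Sb [measurable]: "S s \<in> sets borel" for s unfolding S_def by measurable
      have annulus: "logarea (S s) \<le> ennreal (C * s powr (- \<epsilon>)) * logarea B" if s: "s \<ge> r" for s
      proof -
        have s1: "s \<ge> 1" "8 * s \<ge> r1" "8 * s \<ge> R" using s elim by auto
        have M: "max_modulus f (8 * s) \<ge> 1" using R s1 by (smt (verit))
        have "logarea (S s) \<le> ennreal (ln (2 * max_modulus f (8 * s)) * s powr (- 2 * (\<rho> / 2 + \<epsilon>))) * logarea B"
          using Bfar rho eps s1 M by (intro logarea_preimage_annulus_le hol B) (auto simp: S_def)
        also have "\<dots> \<le> ennreal (C * s powr (- \<epsilon>)) * logarea B"
        proof (intro mult_right_mono ennreal_leI)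
          have "ln (2 * max_modulus f (8 * s)) = ln 2 + ln (max_modulus f (8 * s))"
            using M by (simp add: ln_mult)
          also have "\<dots> \<le> 1 + (8 * s) powr K"
          proof (intro add_mono)
            show "ln 2 \<le> (1::real)" using ln_2_less_1 by simp
            have "ln (max_modulus f (8 * s)) \<le> ln (exp ((8 * s) powr K))"
              using M r1[OF s1(2)] by (subst ln_le_cancel_iff) auto
            then show "ln (max_modulus f (8 * s)) \<le> (8 * s) powr K" by simp
          qed
          also have "\<dots> \<le> 2 * (8 * s) powr K"
            using s1 K ge_one_powr_ge_zero[of "8 * s" K] by simp
          also have "\<dots> = C * s powr K" using s1 by (simp add: C_def powr_mult)
          finally have "ln (2 * max_modulus f (8 * s)) * s powr (- 2 * (\<rho> / 2 + \<epsilon>))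
             \<le> C * s powr K * s powr (- 2 * (\<rho> / 2 + \<epsilon>))"
            by (intro mult_right_mono) auto
          also have "\<dots> = C * s powr (K + - 2 * (\<rho> / 2 + \<epsilon>))"
            by (simp only: powr_add mult.assoc)
          also have "K + - 2 * (\<rho> / 2 + \<epsilon>) = - \<epsilon>"
            by (simp add: K_def field_simps)
          finally show "ln (2 * max_modulus f (8 * s)) * s powr (- 2 * (\<rho> / 2 + \<epsilon>)) \<le> C * s powr (- \<epsilon>)" .
        qed auto
        finally show ?thesis .
      qed
      have cover: "{z. r \<le> norm z \<and> norm (z * deriv f z / f z) \<ge> norm z powr (\<rho> / 2 + \<epsilon>) \<and> f z \<in> B}
         \<subseteq> (\<Union>k. S (2 ^ k * r))" (is "?T \<subseteq> _")
      proof
        fix z assume z: "z \<in> ?T"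
        define k where "k = (LEAST k. norm z < 2 ^ Suc k * r)"
        have "\<exists>k. norm z < 2 ^ Suc k * r"
        proof -
          obtain k where "norm z / r < 2 ^ k" using real_arch_pow[of 2] by auto
          also have "(2::real) ^ k \<le> 2 ^ Suc k" by simp
          finally have "norm z < 2 ^ Suc k * r" using elim by (simp add: field_simps)
          then show ?thesis ..
        qed
        then have k1: "norm z < 2 ^ Suc k * r" unfolding k_def by (rule LeastI_ex)
        have k2: "2 ^ k * r \<le> norm z"
        proof (cases k)
          case 0
          then show ?thesis using z by simp
        next
          case (Suc j)
          then have "\<not> norm z < 2 ^ Suc j * r"
            using not_less_Least[of j "\<lambda>k. norm z < 2 ^ Suc k * r"] by (simp add: k_def)
          then show ?thesis using Suc by simp
        qed
        show "z \<in> (\<Union>k. S (2 ^ k * r))"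
          using z k1 k2 by (auto simp: S_def intro!: exI[of _ k])
      qed
      have "logarea ?T \<le> logarea (\<Union>k. S (2 ^ k * r))" using cover by (rule logarea_mono)
      also have "\<dots> = emeasure log_measure (\<Union>k. S (2 ^ k * r))"
        by (rule logarea_eq_emeasure) measurable
      also have "\<dots> \<le> (\<Sum>k. emeasure log_measure (S (2 ^ k * r)))"
        by (intro emeasure_subadditive_countably) auto
      also have "\<dots> = (\<Sum>k. logarea (S (2 ^ k * r)))" by (simp add: logarea_eq_emeasure)
      also have "\<dots> \<le> (\<Sum>k. ennreal (C * r powr (- \<epsilon>) * q ^ k) * logarea B)"
      proof (intro suminf_le summableI)
        fix k
        have "(2 ^ k * r) powr (- \<epsilon>) = q ^ k * r powr (- \<epsilon>)"
          using elim by (simp add: powr_mult q_def powr_power powr_realpow[symmetric] powr_powr mult.commute)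
        moreover have "1 * r \<le> 2 ^ k * r" using elim by (intro mult_right_mono) auto
        ultimately show "logarea (S (2 ^ k * r)) \<le> ennreal (C * r powr (- \<epsilon>) * q ^ k) * logarea B"
          using annulus[of "2 ^ k * r"] by (simp add: mult_ac)
      qed
      also have "\<dots> = (\<Sum>k. ennreal (C * r powr (- \<epsilon>) * q ^ k)) * logarea B"
        by (rule ennreal_suminf_multc)
      also have "(\<Sum>k. ennreal (C * r powr (- \<epsilon>) * q ^ k)) = ennreal (C * r powr (- \<epsilon>) * (1 / (1 - q)))"
        using q by (intro suminf_ennreal_eq sums_mult geometric_sums) (auto simp: C_def)
      also have "\<dots> * logarea B \<le> ennreal (1 / 2) * logarea B"
        using elim by (intro mult_right_mono ennreal_leI) auto
      finally show "logarea ?T \<le> ennreal (1 / 2) * logarea B" .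
    qed
  qed
qed

text \<open>
  The set \<open>B n\<close> of points outside a large disc whose orbit enters \<open>E\<close> at time \<open>n\<close> for the first time has
  logarithmic area at most \<open>(1/2)\<^sup>n\<close> times that of \<open>E\<close>. The set \<open>X\<close> of all points outside the disc that lie
  in no \<open>B n\<close> is forward invariant: an image in \<open>B n\<close> would put the point itself into \<open>B (n + 1)\<close>.
\<close>
lemma ex_logarea_cofinite_good_set:
  assumes hol: "f holomorphic_on UNIV" and R: "\<forall>r\<ge>R. max_modulus f r > r"
    and order: "entire_order f = ereal \<rho>" and eps: "\<epsilon> > 0"
    and small: "logarea {z \<in> Delta. norm (z * deriv f z / f z) < norm z powr (\<rho> / 2 + \<epsilon>)
                               \<or> norm (f z) < exp (norm z powr \<epsilon>)} < \<infinity>"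
  shows "\<exists>X. logarea (Delta - X) < \<infinity> \<and>
    (\<forall>z\<in>X. f z \<in> X \<and> norm z \<ge> 1 \<and> norm (f z) \<ge> exp (norm z powr \<epsilon>) \<and> norm (f z) \<ge> 2 * norm z
       \<and> norm (z * deriv f z / f z) \<ge> 2)"
proof -
  have rho: "\<rho> \<ge> 0" by (rule entire_order_nonneg[OF order R])
  have [measurable]: "f \<in> borel_measurable borel" "deriv f \<in> borel_measurable borel"
    using hol by (auto intro!: borel_measurable_entire holomorphic_deriv)
  have "eventually (\<lambda>r::real. exp (r powr \<epsilon>) \<ge> 2 * r) at_top"
    using eps by real_asymp
  moreover have "eventually (\<lambda>r::real. r powr \<epsilon> \<ge> 2) at_top"
    using eps by real_asymp
  moreover note logarea_preimage_le_half[OF hol R order eps]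
  ultimately have "eventually (\<lambda>r. exp (r powr \<epsilon>) \<ge> 2 * r \<and> r powr \<epsilon> \<ge> 2 \<and> 
     (\<forall>B\<in>sets borel. (\<forall>w\<in>B. norm (w - f 0) \<ge> 1) \<longrightarrow>
     logarea {z. r \<le> norm z \<and> norm (z * deriv f z / f z) \<ge> norm z powr (\<rho> / 2 + \<epsilon>) \<and> f z \<in> B}
       \<le> ennreal (1 / 2) * logarea B)) at_top"
    by eventually_elim blast
  then obtain r1 where r1: "\<And>r. r \<ge> r1 \<Longrightarrow> exp (r powr \<epsilon>) \<ge> 2 * r" "\<And>r. r \<ge> r1 \<Longrightarrow> r powr \<epsilon> \<ge> 2"
    "\<And>r B. r \<ge> r1 \<Longrightarrow> B \<in> sets borel \<Longrightarrow> (\<forall>w\<in>B. norm (w - f 0) \<ge> 1) \<Longrightarrow>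
     logarea {z. r \<le> norm z \<and> norm (z * deriv f z / f z) \<ge> norm z powr (\<rho> / 2 + \<epsilon>) \<and> f z \<in> B}
       \<le> ennreal (1 / 2) * logarea B"
    unfolding eventually_at_top_linorder by meson
  define r0 where "r0 = max r1 (1 + norm (f 0))"
  have "r0 \<ge> r1" "r0 \<ge> 1 + norm (f 0)" by (simp_all add: r0_def)
  moreover from this(2) have "r0 \<ge> 1" using norm_ge_zero[of "f 0"] by linarith
  ultimately have r0: "r0 \<ge> r1" "r0 \<ge> 1 + norm (f 0)" "r0 \<ge> 1" by blast+
  define E where "E = {z \<in> Delta. norm (z * deriv f z / f z) < norm z powr (\<rho> / 2 + \<epsilon>)
                               \<or> norm (f z) < exp (norm z powr \<epsilon>)}"
  have E [measurable]: "E \<in> sets borel" unfolding E_def by measurable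
  define B where "B n = ((\<lambda>A. {z. r0 \<le> norm z \<and> z \<notin> E \<and> f z \<in> A}) ^^ n) {z. r0 \<le> norm z \<and> z \<in> E}" for n
  have B0: "B 0 = {z. r0 \<le> norm z \<and> z \<in> E}" and BS: "B (Suc n) = {z. r0 \<le> norm z \<and> z \<notin> E \<and> f z \<in> B n}" for n
    by (simp_all add: B_def)
  have Bb [measurable]: "B n \<in> sets borel" for n
  proof (induction n)
    case 0
    show ?case unfolding B0 by measurable
  next
    case (Suc n)
    note [measurable] = Suc
    show ?case unfolding BS by measurable
  qed
  have Br0: "z \<in> B n \<Longrightarrow> r0 \<le> norm z" for z n by (cases n) (auto simp: B0 BS)
  have half: "logarea (B (Suc n)) \<le> ennreal (1 / 2) * logarea (B n)" for n
  proof -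
    have "norm (w - f 0) \<ge> 1" if "w \<in> B n" for w
      using Br0[OF that] r0 norm_triangle_ineq2[of w "f 0"] by linarith
    then have "logarea {z. r0 \<le> norm z \<and> norm (z * deriv f z / f z) \<ge> norm z powr (\<rho> / 2 + \<epsilon>) \<and> f z \<in> B n}
       \<le> ennreal (1 / 2) * logarea (B n)"
      by (intro r1(3)) (use r0 in auto)
    moreover have "B (Suc n) \<subseteq> {z. r0 \<le> norm z \<and> norm (z * deriv f z / f z) \<ge> norm z powr (\<rho> / 2 + \<epsilon>) \<and> f z \<in> B n}"
      using r0 by (auto simp: BS E_def Delta_def)
    ultimately show ?thesis using logarea_mono order_trans by blast
  qed
  have geom: "logarea (B n) \<le> ennreal ((1 / 2) ^ n) * logarea E" for n
  proof (induction n)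
    case 0
    show ?case by (auto simp: B0 intro: logarea_mono)
  next
    case (Suc n)
    have "logarea (B (Suc n)) \<le> ennreal (1 / 2) * logarea (B n)" by (rule half)
    also have "\<dots> \<le> ennreal (1 / 2) * (ennreal ((1 / 2) ^ n) * logarea E)"
      by (intro mult_left_mono Suc) auto
    also have "\<dots> = (ennreal (1 / 2) * ennreal ((1 / 2) ^ n)) * logarea E"
      by (simp only: mult.assoc)
    also have "ennreal (1 / 2) * ennreal ((1 / 2) ^ n) = ennreal ((1 / 2) ^ Suc n)"
      by (subst ennreal_mult[symmetric]) auto
    finally show ?case .
  qed
  define X where "X = {z. r0 \<le> norm z} - (\<Union>n. B n)"
  have "logarea (\<Union>n. B n) < \<infinity>"
  proof -
    have "logarea (\<Union>n. B n) = emeasure log_measure (\<Union>n. B n)"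
      by (rule logarea_eq_emeasure) measurable
    also have "\<dots> \<le> (\<Sum>n. emeasure log_measure (B n))"
      by (intro emeasure_subadditive_countably) auto
    also have "\<dots> = (\<Sum>n. logarea (B n))" by (simp add: logarea_eq_emeasure)
    also have "\<dots> \<le> (\<Sum>n. ennreal ((1 / 2) ^ n) * logarea E)"
      by (intro suminf_le summableI geom)
    also have "\<dots> = (\<Sum>n. ennreal ((1 / 2) ^ n)) * logarea E" by (rule ennreal_suminf_multc)
    also have "(\<Sum>n. ennreal ((1 / 2) ^ n)) = ennreal (1 / (1 - 1 / 2))"
      by (intro suminf_ennreal_eq geometric_sums) auto
    also have "\<dots> * logarea E < \<infinity>"
      using small by (simp add: E_def ennreal_mult_less_top)
    finally show ?thesis .
  qed
  moreover have "logarea (Delta \<inter> ball 0 r0) < \<infinity>"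
    using r0 by (intro logarea_Delta_ball_finite) auto
  moreover have "logarea (Delta - X) \<le> logarea (Delta \<inter> ball 0 r0) + logarea (\<Union>n. B n)"
  proof -
    have "logarea (Delta - X) \<le> logarea ((Delta \<inter> ball 0 r0) \<union> (\<Union>n. B n))"
      by (rule logarea_mono) (auto simp: X_def)
    also have "\<dots> \<le> logarea (Delta \<inter> ball 0 r0) + logarea (\<Union>n. B n)"
      using emeasure_subadditive[of "Delta \<inter> ball 0 r0" log_measure "\<Union>n. B n"]
      by (simp add: logarea_eq_emeasure)
    finally show ?thesis .
  qed
  ultimately have "logarea (Delta - X) < \<infinity>"
    by (simp add: le_less_trans)
  moreover have "f z \<in> X \<and> norm z \<ge> 1 \<and> norm (f z) \<ge> exp (norm z powr \<epsilon>) \<and> norm (f z) \<ge> 2 * norm z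
       \<and> norm (z * deriv f z / f z) \<ge> 2" if z: "z \<in> X" for z
  proof -
    have zr: "r0 \<le> norm z" and zB: "\<And>n. z \<notin> B n" using z by (auto simp: X_def)
    then have zE: "z \<notin> E" using B0 zB[of 0] by auto
    have z1: "norm z \<ge> 1" "norm z \<ge> r1" using zr r0 by auto
    have good: "norm (z * deriv f z / f z) \<ge> norm z powr (\<rho> / 2 + \<epsilon>)" "norm (f z) \<ge> exp (norm z powr \<epsilon>)"
      using zE z1 by (auto simp: E_def Delta_def)
    have two: "norm (f z) \<ge> 2 * norm z" using good(2) r1(1)[OF z1(2)] by linarith
    have "norm z powr \<epsilon> \<le> norm z powr (\<rho> / 2 + \<epsilon>)"
      using z1 rho by (intro powr_mono) auto
    then have "norm (z * deriv f z / f z) \<ge> 2" using good(1) r1(2)[OF z1(2)] by linarith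
    moreover have "f z \<in> X"
    proof -
      have "r0 \<le> norm (f z)" using two zr z1 by linarith
      moreover have "f z \<notin> B n" for n
        using zB[of "Suc n"] zr zE by (auto simp: BS)
      ultimately show ?thesis by (auto simp: X_def)
    qed
    ultimately show ?thesis using z1 good two by blast
  qed
  ultimately show ?thesis by blast
qed

lemma fast_escaping_set_borel:
  assumes hol: "f holomorphic_on UNIV"
  shows "fast_escaping_set f R \<in> sets borel"
proof -
  have [measurable]: "(f ^^ n) \<in> borel_measurable borel" for n
    by (intro borel_measurable_entire holomorphic_funpow hol)
  show ?thesis unfolding fast_escaping_set_def by measurable
qed

theorem theorem1p2:
  fixes f :: "complex \<Rightarrow> complex" and \<rho> \<epsilon> R :: real
  assumes entire: "f holomorphic_on UNIV"
    and nonlinear: "\<nexists>a b. \<forall>z. f z = a * z + b"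
    and order: "entire_order f = ereal \<rho>"
    and R: "R > 0" "\<forall>r\<ge>R. max_modulus f r > r"
    and eps: "\<epsilon> > 0"
    and small: "logarea {z \<in> Delta. norm (z * deriv f z / f z) < norm z powr (\<rho> / 2 + \<epsilon>)
                               \<or> norm (f z) < exp (norm z powr \<epsilon>)} < \<infinity>"
  shows "logarea (Delta - fast_escaping_set f R) < \<infinity>
    \<and> area (fast_escaping_set f R) > 0
    \<and> ((\<forall>C \<in> components (fatou_set f). simply_connected C) \<longrightarrow>
         logarea (Delta - (fast_escaping_set f R \<inter> julia_set f)) < \<infinity>
         \<and> area (fast_escaping_set f R \<inter> julia_set f) > 0)"
proof -
  obtain X where X: "logarea (Delta - X) < \<infinity>"
    and fX: "\<And>z. z \<in> X \<Longrightarrow> f z \<in> X"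
    and X1: "\<And>z. z \<in> X \<Longrightarrow> norm z \<ge> 1"
    and Xexp: "\<And>z. z \<in> X \<Longrightarrow> norm (f z) \<ge> exp (norm z powr \<epsilon>)"
    and Xdouble: "\<And>z. z \<in> X \<Longrightarrow> norm (f z) \<ge> 2 * norm z"
    and Xexpand: "\<And>z. z \<in> X \<Longrightarrow> norm (z * deriv f z / f z) \<ge> 2"
    using ex_logarea_cofinite_good_set[OF entire R(2) order eps small] by blast
  have orbit: "(f ^^ n) z \<in> X" if "z \<in> X" for z n
    by (induction n) (use that fX in auto)
  have escape: "filterlim (\<lambda>n. norm ((f ^^ n) z)) at_top sequentially" if z: "z \<in> X" for z
  proof (rule filterlim_at_top_mono)
    show "filterlim (\<lambda>n::nat. (2::real) ^ n) at_top sequentially" by real_asymp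
    have "2 ^ n \<le> norm ((f ^^ n) z)" for n
    proof (induction n)
      case (Suc n)
      then show ?case using Xdouble[OF orbit[OF z, of n]] by simp
    qed (use X1[OF z] in simp)
    then show "eventually (\<lambda>n. 2 ^ n \<le> norm ((f ^^ n) z)) sequentially" by simp
  qed
  have fast: "X \<subseteq> fast_escaping_set f R"
  proof
    fix z assume z: "z \<in> X"
    have "\<exists>L. \<forall>n>L. norm ((f ^^ n) z) \<ge> (max_modulus f ^^ (n - L)) R"
      using Xexp orbit[OF z] escape[OF z]
      by (intro iterates_exceed_max_modulus[OF entire R max_modulus_le_exp_powr[OF order R(2), of "\<rho> + 1"] eps]) auto
    then show "z \<in> fast_escaping_set f R" by (simp add: fast_escaping_set_def)
  qed
  have *: "logarea (Delta - Y) < \<infinity> \<and> area Y > 0" if "X \<subseteq> Y" "Y \<in> sets borel" for Y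
  proof -
    have "logarea (Delta - Y) < \<infinity>"
      using that(1) X logarea_mono[of "Delta - Y" "Delta - X"] by (meson Diff_mono order_refl le_less_trans)
    then show ?thesis using area_pos_if_logarea_cofinite that(2) by blast
  qed
  have "X \<subseteq> julia_set f" if "\<forall>C \<in> components (fatou_set f). simply_connected C"
  proof
    fix z assume z: "z \<in> X"
    show "z \<in> julia_set f"
    proof (rule expanding_orbit_in_julia_set[OF entire nonlinear that])
      show "z \<in> escaping_set f"
        using escape[OF z] by (simp add: escaping_set_def filterlim_norm_at_top_imp_at_infinity)
      show "let w = (f ^^ n) z in 2 \<le> norm (w * deriv f w / f w)" for n
        using Xexpand[OF orbit[OF z]] by (simp add: Let_def)
    qed
  qed
  moreover have "julia_set f \<in> sets borel"
    unfolding julia_set_def using open_fatou_set by auto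
  ultimately show ?thesis
    using * fast fast_escaping_set_borel[OF entire] by auto
qed

end
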